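(* Assume (A.a) and (A.b). Let $\beta\in[0,1)$, $\lambda\in[0,\frac{\beta}{1-\beta}]$, step sizes $\alpha_k\in\big(0,\frac{(1-\beta)(1-\beta^m)}{4Lm}\big]$ for all $k$, let the sequences be generated by RRM, and let $T\ge1$. (a) (Arbitrary permutations.) If $\sum_{k=1}^T\alpha_k^3\le\frac{1}{Dm^3}$, then \[ \min_{k=1,\dots,T}\|\nabla f(x^k)\|^2\le\frac{1+3Dm^3\sum_{k=1}^T\alpha_k^3}{m\sum_{k=1}^T\alpha_k}\cdot16(1-\beta)[f(x^1)-\bar f]. \] (b) If in addition (A.c) holds and $\sum_{k=1}^T\alpha_k^3\le\frac{b}{Dm^2}$, then \[ \min_{k=1,\dots,T}\mathbb E[\|\nabla f(x^k)\|^2]\le\frac{1+3Dm^2b^{-1}\sum_{k=1}^T\alpha_k^3}{m\sum_{k=1}^T\alpha_k}\cdot16(1-\beta)[f(x^1)-\bar f]. \]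
   Context: Let $n,d\in\mathbb N$, $f_1,\dots,f_n:\mathbb R^d\to\mathbb R$ continuously differentiable, $f:=\frac1n\sum_{i=1}^n f_i$, $[n]:=\{1,\dots,n\}$. Fix a mini-batch size $b\in\mathbb N$ with $m:=n/b\in\mathbb N$. Random reshuffling with momentum (RRM) with step sizes $\{\alpha_k\}_{k\ge1}\subset(0,\infty)$ and parameters $\beta,\lambda$ generates sequences as follows: start with $x^1=\tilde x^1\in\mathbb R^d$; for each $k=1,2,\dots$ choose a permutation $\pi^k=(\pi^k_1,\dots,\pi^k_n)$ of $[n]$, set $y_0^k=\tilde x^k$, $y_1^k=x^k$, and for $i=1,\dots,m$ compute $\hat y_i^k=y_i^k+\lambda(y_i^k-y_{i-1}^k)$, $d_i^k=\frac1b\sum_{j=(i-1)b+1}^{ib}\nabla f_{\pi^k_j}(\hat y_i^k)$, $y_{i+1}^k=y_i^k-\alpha_kd_i^k+\beta(y_i^k-y_{i-1}^k)$; then set $\tilde x^{k+1}=y_m^k$, $x^{k+1}=y_{m+1}^k$. Assumption (A.a): there are $L>0$ and $\bar f\in\mathbb R$ such that each $\nabla f_i$ is $L$-Lipschitz and $f_i(x)\ge\bar f$ for all $x\in\mathbb R^d$, $i\in[n]$. Assumption (A.b): $\{\alpha_k\}_k$ is non-increasing. Assumption (A.c): the permutations $\pi^1,\pi^2,\dots$ are independent and each is uniformly distributed over all permutations of $[n]$. Constant: $D:=\frac{10}{(1-\beta^m)^2}\big(\frac{L}{1-\beta}\big)^3$. *)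

theory Defs
  imports "HOL-Analysis.Analysis" "HOL-Combinatorics.Permutations"
begin

text \<open>Inner loop of RRM in epoch k. The state after i inner steps is the pair
  (y_i, y_(i+1)); the starting state is (y_0, y_1) = (xtilde^k, x^k).
  g i is the gradient of f_i, b the batch size, a the step size alpha_k,
  p the permutation pp^k (a permutation of {1..n}).\<close>
fun rrm_inner :: "(nat \<Rightarrow> 'a::real_vector \<Rightarrow> 'a) \<Rightarrow> nat \<Rightarrow> real \<Rightarrow> real \<Rightarrow> real
    \<Rightarrow> (nat \<Rightarrow> nat) \<Rightarrow> 'a \<times> 'a \<Rightarrow> nat \<Rightarrow> 'a \<times> 'a" where
  "rrm_inner g b a bet lam p s 0 = s"
| "rrm_inner g b a bet lam p s (Suc i) =
     (let yp = fst (rrm_inner g b a bet lam p s i);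
          y  = snd (rrm_inner g b a bet lam p s i);
          yh = y + lam *\<^sub>R (y - yp);
          d  = (1 / real b) *\<^sub>R (\<Sum>j\<in>{i*b+1..(Suc i)*b}. g (p j) yh)
      in (y, y - a *\<^sub>R d + bet *\<^sub>R (y - yp)))"

text \<open>Outer loop: rrm_state ... k = (xtilde^k, x^k) for k \<ge> 1 (epochs are 1-indexed;
  the value at k = 0 is a dummy equal to (x^1, x^1)).\<close>
fun rrm_state :: "(nat \<Rightarrow> 'a::real_vector \<Rightarrow> 'a) \<Rightarrow> nat \<Rightarrow> nat \<Rightarrow> (nat \<Rightarrow> real) \<Rightarrow> real \<Rightarrow> real
    \<Rightarrow> (nat \<Rightarrow> nat \<Rightarrow> nat) \<Rightarrow> 'a \<Rightarrow> nat \<Rightarrow> 'a \<times> 'a" where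
  "rrm_state g b m alpha bet lam pp x1 0 = (x1, x1)"
| "rrm_state g b m alpha bet lam pp x1 (Suc 0) = (x1, x1)"
| "rrm_state g b m alpha bet lam pp x1 (Suc (Suc k)) =
     rrm_inner g b (alpha (Suc k)) bet lam (pp (Suc k))
       (rrm_state g b m alpha bet lam pp x1 (Suc k)) m"

definition rrm_x :: "(nat \<Rightarrow> 'a::real_vector \<Rightarrow> 'a) \<Rightarrow> nat \<Rightarrow> nat \<Rightarrow> (nat \<Rightarrow> real) \<Rightarrow> real \<Rightarrow> real
    \<Rightarrow> (nat \<Rightarrow> nat \<Rightarrow> nat) \<Rightarrow> 'a \<Rightarrow> nat \<Rightarrow> 'a" where
  "rrm_x g b m alpha bet lam pp x1 k = snd (rrm_state g b m alpha bet lam pp x1 k)"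

text \<open>Set of permutation sequences (pp^1,...,pp^T), each pp^k a permutation of {1..n}.
  Under (A.c) these are uniformly distributed on this finite set (independent and uniform).\<close>
definition perm_seqs :: "nat \<Rightarrow> nat \<Rightarrow> (nat \<Rightarrow> nat \<Rightarrow> nat) set" where
  "perm_seqs n T = PiE {1..T} (\<lambda>_. {p. p permutes {1..n}})"

definition perm_expect :: "nat \<Rightarrow> nat \<Rightarrow> ((nat \<Rightarrow> nat \<Rightarrow> nat) \<Rightarrow> real) \<Rightarrow> real" where
  "perm_expect n T F = (\<Sum>pp\<in>perm_seqs n T. F pp) / real (card (perm_seqs n T))"

end

theory Submission
  imports Defs
begin

text \<open>
  With \<open>z = (x - \<beta> \<cdot> xtilde) / (1 - \<beta>)\<close> momentum disappears: over one epoch \<open>z\<close> moves by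
  \<open>-\<tau>\<close> times the average of the mini-batch gradients, where \<open>\<tau> = m \<cdot> \<alpha> / (1 - \<beta>)\<close>. Put
  \<open>u = \<beta> / (1 - \<beta>) \<cdot> (x - xtilde) = z - x\<close> and \<open>s = 1 - \<beta> ^ m\<close>. The Lyapunov function
  \<open>f z - fbar + 7/4 \<cdot> L\<^sup>2 \<cdot> \<tau> / s \<cdot> norm u ^ 2\<close> decreases by \<open>\<tau> / 16 \<cdot> norm (\<nabla>f x) ^ 2\<close> per epoch,
  up to a noise term of order \<open>L\<^sup>2 \<cdot> \<tau>\<^sup>3 / s\<^sup>2\<close> times the squared partial sums of the deviations
  \<open>\<nabla>f_i z - \<nabla>f z\<close> taken in the order of the permutation. These deviations sum to zero, and the
  sum of their squares is at most \<open>2 \<cdot> L \<cdot> n \<cdot> (f z - fbar)\<close>, so the noise is at most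
  \<open>D \<cdot> m ^ 3 \<cdot> \<alpha> ^ 3\<close> times the Lyapunov function; for a uniformly random permutation, sampling
  without replacement gains a factor \<open>n\<close> on average. A discrete Gronwall argument finishes the proof.
\<close>

section \<open>Smooth functions and elementary sums\<close>

text \<open>The descent lemma. Along the segment from \<open>x\<close> to \<open>y\<close>, the
  excess of \<open>f\<close> over its quadratic model has nonpositive derivative, by Cauchy-Schwarz
  and the Lipschitz bound.\<close>

lemma lipschitz_gradient_upper_bound:
  fixes f :: "'a::real_inner \<Rightarrow> real" and g :: "'a \<Rightarrow> 'a"
  assumes der: "\<And>x. (f has_derivative (\<lambda>h. g x \<bullet> h)) (at x)"
    and lip: "\<And>x y. norm (g x - g y) \<le> L * norm (x - y)"
  shows "f y \<le> f x + g x \<bullet> (y - x) + L / 2 * (norm (y - x))\<^sup>2"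
proof -
  define w where "w = y - x"
  define \<phi> where "\<phi> s = f (x + s *\<^sub>R w) - s * (g x \<bullet> w) - L / 2 * s\<^sup>2 * (norm w)\<^sup>2" for s :: real
  have d: "(\<phi> has_real_derivative (g (x + s *\<^sub>R w) \<bullet> w - g x \<bullet> w - L * s * (norm w)\<^sup>2)) (at s)" for s
  proof -
    have "((\<lambda>s. x + s *\<^sub>R w) has_derivative (\<lambda>h. h *\<^sub>R w)) (at s)"
      by (auto intro!: derivative_eq_intros)
    from diff_chain_at[OF this der]
    have "((\<lambda>s. f (x + s *\<^sub>R w)) has_derivative (\<lambda>h. h * (g (x + s *\<^sub>R w) \<bullet> w))) (at s)"
      by (simp add: o_def)
    hence "((\<lambda>s. f (x + s *\<^sub>R w)) has_real_derivative (g (x + s *\<^sub>R w) \<bullet> w)) (at s)"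
      by (simp add: has_field_derivative_def mult_commute_abs)
    thus ?thesis unfolding \<phi>_def by (auto intro!: derivative_eq_intros)
  qed
  have "\<phi> 1 \<le> \<phi> 0"
  proof (rule DERIV_nonpos_imp_nonincreasing[of 0 1 \<phi>])
    fix s :: real assume s: "0 \<le> s" "s \<le> 1"
    have "(g (x + s *\<^sub>R w) - g x) \<bullet> w \<le> norm (g (x + s *\<^sub>R w) - g x) * norm w"
      by (rule norm_cauchy_schwarz)
    also have "\<dots> \<le> (L * norm (x + s *\<^sub>R w - x)) * norm w"
      by (intro mult_right_mono lip) auto
    also have "\<dots> = L * s * (norm w)\<^sup>2" using s by (simp add: power2_eq_square)
    finally show "\<exists>D. (\<phi> has_real_derivative D) (at s) \<and> D \<le> 0"
      using d[of s] by (auto simp: inner_diff_left)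
  qed simp
  thus ?thesis by (simp add: \<phi>_def w_def)
qed

text \<open>A gradient step of length \<open>1 / L\<close> lowers \<open>f\<close> by at least
  \<open>(norm (g x))\<^sup>2 / (2 * L)\<close>, and the value reached is still at least
  \<open>c\<close>.\<close>

lemma gradient_norm_sq_le_gap:
  fixes f :: "'a::real_inner \<Rightarrow> real" and g :: "'a \<Rightarrow> 'a"
  assumes der: "\<And>x. (f has_derivative (\<lambda>h. g x \<bullet> h)) (at x)"
    and lip: "\<And>x y. norm (g x - g y) \<le> L * norm (x - y)"
    and L: "L > 0" and low: "\<And>x. c \<le> f x"
  shows "(norm (g x))\<^sup>2 \<le> 2 * L * (f x - c)"
proof -
  have "c \<le> f (x - (1 / L) *\<^sub>R g x)" by (rule low)
  also have "\<dots> \<le> f x + g x \<bullet> (x - (1 / L) *\<^sub>R g x - x) + L / 2 * (norm (x - (1 / L) *\<^sub>R g x - x))\<^sup>2"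
    by (rule lipschitz_gradient_upper_bound[OF der lip])
  also have "\<dots> = f x - (norm (g x))\<^sup>2 / (2 * L)"
    using L by (simp add: power2_norm_eq_inner power_divide field_simps)
               (simp add: power2_eq_square field_simps)
  finally show ?thesis using L by (simp add: field_simps)
qed

text \<open>Cauchy-Schwarz after splitting each weight into two square roots. For weights of total
  at most 1, as in the noise terms below, it acts as Jensen's inequality.\<close>

lemma norm_sum_scaleR_sq_le:
  fixes x :: "'i \<Rightarrow> 'a::real_normed_vector"
  assumes "\<And>i. i \<in> I \<Longrightarrow> 0 \<le> w i"
  shows "(norm (\<Sum>i\<in>I. w i *\<^sub>R x i))\<^sup>2 \<le> (\<Sum>i\<in>I. w i) * (\<Sum>i\<in>I. w i * (norm (x i))\<^sup>2)"
proof -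
  have "norm (\<Sum>i\<in>I. w i *\<^sub>R x i) \<le> (\<Sum>i\<in>I. sqrt (w i) * (sqrt (w i) * norm (x i)))"
    using assms by (intro sum_norm_le) (simp flip: mult.assoc)
  hence "(norm (\<Sum>i\<in>I. w i *\<^sub>R x i))\<^sup>2 \<le> (\<Sum>i\<in>I. sqrt (w i) * (sqrt (w i) * norm (x i)))\<^sup>2"
    by (intro power_mono) auto
  also have "\<dots> \<le> (\<Sum>i\<in>I. (sqrt (w i))\<^sup>2) * (\<Sum>i\<in>I. (sqrt (w i) * norm (x i))\<^sup>2)"
    by (rule Cauchy_Schwarz_ineq_sum)
  also have "\<dots> = (\<Sum>i\<in>I. w i) * (\<Sum>i\<in>I. w i * (norm (x i))\<^sup>2)"
    using assms by (simp add: power_mult_distrib)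
  finally show ?thesis .
qed

lemma norm_sum_sq_le:
  fixes x :: "'i \<Rightarrow> 'a::real_normed_vector"
  shows "(norm (\<Sum>i\<in>I. x i))\<^sup>2 \<le> real (card I) * (\<Sum>i\<in>I. (norm (x i))\<^sup>2)"
  using norm_sum_scaleR_sq_le[of I "\<lambda>_. 1" x] by simp

lemma sum_squares_le: "(\<Sum>i<m. (real i)\<^sup>2) \<le> real m ^ 3 / 3"
  by (induction m) (simp_all add: power2_eq_square power3_eq_cube field_simps)

lemma sum_real_le: "(\<Sum>i<m. real i) \<le> (real m)\<^sup>2 / 2"
  by (induction m) (simp_all add: power2_eq_square field_simps)

text \<open>By convexity, \<open>\<beta> ^ j + \<beta> ^ (m - j)\<close> never exceeds its endpoint
  value \<open>1 + \<beta> ^ m\<close>; summing over \<open>j\<close> gives the trapezoid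
  rule.\<close>

lemma sum_power_le_trapezoid:
  fixes \<beta> :: real
  assumes "0 \<le> \<beta>" "\<beta> \<le> 1"
  shows "(\<Sum>j<m. \<beta> ^ (m - j)) \<le> real m * (1 + \<beta> ^ m) / 2"
proof -
  have 1: "\<beta> ^ j + \<beta> ^ (m - j) \<le> 1 + \<beta> ^ m" if "j < m" for j
  proof -
    have "0 \<le> (1 - \<beta> ^ j) * (1 - \<beta> ^ (m - j))"
      using assms by (intro mult_nonneg_nonneg) (auto simp: power_le_one)
    also have "\<dots> = 1 + \<beta> ^ m - \<beta> ^ j - \<beta> ^ (m - j)"
      using that by (simp add: algebra_simps flip: power_add)
    finally show ?thesis by simp
  qed
  \<comment> \<open>The exponents \<open>m - j\<close> run from 1 to \<open>m\<close>. Lowering each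
    by one does not decrease the sum, so the two sums can be paired.\<close>
  have "(\<Sum>j<m. \<beta> ^ (m - j)) = (\<Sum>j<m. \<beta> ^ Suc j)"
    by (subst sum.nat_diff_reindex[symmetric]) (auto intro!: sum.cong arg_cong[where f="\<lambda>k. \<beta> ^ k"])
  also have "\<dots> \<le> (\<Sum>j<m. \<beta> ^ j)"
    using assms by (intro sum_mono) (simp add: mult_left_le_one_le)
  finally have "2 * (\<Sum>j<m. \<beta> ^ (m - j)) \<le> (\<Sum>j<m. \<beta> ^ j + \<beta> ^ (m - j))"
    by (simp add: sum.distrib)
  also have "\<dots> \<le> (\<Sum>j<m. 1 + \<beta> ^ m)" using 1 by (intro sum_mono) auto
  finally show ?thesis by simp
qed

lemma sum_geometric_reversed:
  fixes \<beta> :: real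
  shows "(1 - \<beta>) * (\<Sum>j<i. \<beta> ^ (i - 1 - j)) = 1 - \<beta> ^ i"
proof -
  have "(\<Sum>j<i. \<beta> ^ (i - 1 - j)) = (\<Sum>j<i. \<beta> ^ j)"
    by (subst sum.nat_diff_reindex[symmetric]) (auto intro!: sum.cong)
  thus ?thesis by (simp add: one_diff_power_eq)
qed

section \<open>Drift within one epoch\<close>

text \<open>The L2 norm for the uniform distribution on the \<open>m\<close> inner steps.
  Minkowski's inequality bounds the drift term by term, without the factors that squaring a sum
  would cost.\<close>

definition rms :: "nat \<Rightarrow> (nat \<Rightarrow> real) \<Rightarrow> real" where
  "rms m f = sqrt ((\<Sum>i<m. (f i)\<^sup>2) / real m)"

lemma rms_eq_L2_set: "rms m f = L2_set f {..<m} / sqrt (real m)"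
  by (simp add: rms_def L2_set_def real_sqrt_divide)

lemma rms_nonneg: "0 \<le> rms m f"
  by (simp add: rms_def sum_nonneg)

lemma rms_sq: "(rms m f)\<^sup>2 = (\<Sum>i<m. (f i)\<^sup>2) / real m"
  by (simp add: rms_def sum_nonneg)

lemma rms_add_le: "rms m (\<lambda>i. f i + h i) \<le> rms m f + rms m h"
  unfolding rms_eq_L2_set add_divide_distrib[symmetric]
  by (intro divide_right_mono L2_set_triangle_ineq) simp

lemma rms_mono:
  assumes "\<And>i. i < m \<Longrightarrow> 0 \<le> f i" "\<And>i. i < m \<Longrightarrow> f i \<le> h i"
  shows "rms m f \<le> rms m h"
  unfolding rms_eq_L2_set using assms by (intro divide_right_mono L2_set_mono) auto

lemma rms_cmult:
  assumes "0 \<le> c" shows "rms m (\<lambda>i. c * f i) = c * rms m f"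
  using assms by (simp add: rms_eq_L2_set L2_set_right_distrib[symmetric])

lemma rms_const:
  assumes "0 < m" "0 \<le> c" shows "rms m (\<lambda>_. c) = c"
  using assms by (simp add: rms_def)

lemma rms_le:
  assumes "0 \<le> c" "(\<Sum>i<m. (f i)\<^sup>2) / real m \<le> c\<^sup>2"
  shows "rms m f \<le> c"
  unfolding rms_def using assms by (intro real_le_lsqrt) (auto intro!: divide_nonneg_nonneg sum_nonneg)

text \<open>\<open>3 / 5\<close> is a rational upper bound for 1 / sqrt 3.\<close>

lemma rms_index_le: "rms m (\<lambda>i. real i / real m) \<le> 3 / 5"
proof (rule rms_le)
  have "(\<Sum>i<m. (real i / real m)\<^sup>2) = (\<Sum>i<m. (real i)\<^sup>2) / (real m)\<^sup>2"
    by (simp add: power_divide sum_divide_distrib)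
  also have "\<dots> \<le> (real m ^ 3 / 3) / (real m)\<^sup>2"
    by (intro divide_right_mono sum_squares_le) auto
  finally have "(\<Sum>i<m. (real i / real m)\<^sup>2) / real m \<le> (real m ^ 3 / 3) / (real m)\<^sup>2 / real m"
    by (intro divide_right_mono) auto
  also have "\<dots> \<le> (3 / 5)\<^sup>2"
    by (cases "m = 0") (simp_all add: power2_eq_square power3_eq_cube)
  finally show "(\<Sum>i<m. (real i / real m)\<^sup>2) / real m \<le> (3 / 5)\<^sup>2" .
qed simp

text \<open>Cauchy-Schwarz over the first \<open>i\<close> terms leaves a factor
  \<open>i / m\<close> in the squared bound, whose mean is at most 1/2; \<open>5 / 7\<close> rounds
  1 / sqrt 2 upwards.\<close>

lemma rms_partial_average_le:
  assumes "0 < m"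
  shows "rms m (\<lambda>i. (\<Sum>j<i. f j) / real m) \<le> 5 / 7 * rms m f"
proof (rule rms_le)
  let ?X = "(rms m f)\<^sup>2"
  have 1: "((\<Sum>j<i. f j) / real m)\<^sup>2 \<le> real i / real m * ?X" if "i < m" for i
  proof -
    have "(\<Sum>j<i. f j)\<^sup>2 \<le> real i * (\<Sum>j<i. (f j)\<^sup>2)"
      using norm_sum_sq_le[of f "{..<i}"] by simp
    also have "\<dots> \<le> real i * (\<Sum>j<m. (f j)\<^sup>2)"
      using that by (intro mult_left_mono sum_mono2) auto
    also have "\<dots> = real i * (real m * ?X)"
      using assms by (simp add: rms_sq)
    finally have "(\<Sum>j<i. f j)\<^sup>2 / (real m)\<^sup>2 \<le> real i * (real m * ?X) / (real m)\<^sup>2"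
      by (rule divide_right_mono) simp
    thus ?thesis using assms by (simp add: power_divide power2_eq_square)
  qed
  have "(\<Sum>i<m. ((\<Sum>j<i. f j) / real m)\<^sup>2) \<le> (\<Sum>i<m. real i / real m * ?X)"
    using 1 by (intro sum_mono) auto
  also have "\<dots> = (\<Sum>i<m. real i) * (?X / real m)" by (simp add: sum_distrib_right sum_divide_distrib)
  also have "\<dots> \<le> (real m)\<^sup>2 / 2 * (?X / real m)"
    by (intro mult_right_mono sum_real_le) auto
  also have "\<dots> = real m * (?X / 2)" using assms by (simp add: power2_eq_square)
  finally have "(\<Sum>i<m. ((\<Sum>j<i. f j) / real m)\<^sup>2) / real m \<le> ?X / 2"
    using assms by (simp add: field_simps)
  also have "\<dots> \<le> (5 / 7 * rms m f)\<^sup>2" by (simp add: power_mult_distrib power_divide)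
  finally show "(\<Sum>i<m. ((\<Sum>j<i. f j) / real m)\<^sup>2) / real m \<le> (5 / 7 * rms m f)\<^sup>2" .
qed (simp add: rms_nonneg)

text \<open>One epoch in abstract form: \<open>v i\<close> is the current velocity, the difference
  of two successive inner iterates, and \<open>z i\<close> the momentum-free shifted iterate. With
  \<mu> equal to \<beta> / (1 - \<beta>) minus the extrapolation parameter,
  \<open>z i - \<mu> *\<^sub>R v i\<close> is the point where gradients are evaluated. Each
  \<open>d i\<close> splits into the full gradient \<open>G\<close> at \<open>z 0\<close>, the
  sampling deviation \<open>r i\<close> at \<open>z 0\<close>, and an error caused by the drift away
  from \<open>z 0\<close>.\<close>

locale rrm_epoch =
  fixes m :: nat and L a \<beta> \<mu> :: real and G :: "'a::real_inner" and d r v z :: "nat \<Rightarrow> 'a"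
  assumes m_pos: "0 < m" and L_pos: "0 < L" and a_pos: "0 < a"
    and beta: "0 \<le> \<beta>" "\<beta> < 1" and mu: "0 \<le> \<mu>" "\<mu> \<le> \<beta> / (1 - \<beta>)"
    and a_le: "a \<le> (1 - \<beta>) * (1 - \<beta> ^ m) / (4 * L * real m)"
    and v_Suc: "\<And>i. i < m \<Longrightarrow> v (Suc i) = \<beta> *\<^sub>R v i - a *\<^sub>R d i"
    and z_Suc: "\<And>i. i < m \<Longrightarrow> z (Suc i) = z i - (a / (1 - \<beta>)) *\<^sub>R d i"
    and d_err: "\<And>i. i < m \<Longrightarrow> norm (d i - G - r i) \<le> L * norm (z i - \<mu> *\<^sub>R v i - z 0)"
    and sum_r: "(\<Sum>i<m. r i) = 0"
begin

definition \<tau> where "\<tau> = real m * a / (1 - \<beta>)"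
definition s where "s = 1 - \<beta> ^ m"
definition u where "u i = (\<beta> / (1 - \<beta>)) *\<^sub>R v i"
definition err where "err i = z i - \<mu> *\<^sub>R v i - z 0"
definition R where "R i = (\<Sum>j<i. r j)"
text \<open>\<open>Z\<close> is the response of the velocity recursion to the noise
  \<open>r\<close>, and \<open>S i\<close> is the total noise that reaches the drift
  \<open>err i\<close>. \<open>C\<close> and \<open>C'\<close> are the resulting noise terms in the
  bounds for \<open>X\<close> and for \<open>u m\<close>; the division by \<open>s\<close> in
  \<open>C'\<close> matches the contraction rate of \<open>u\<close>.\<close>

definition Z where "Z i = (\<Sum>j<i. \<beta> ^ (i - 1 - j) *\<^sub>R r j)"
definition S where "S i = R i - (\<mu> * (1 - \<beta>)) *\<^sub>R Z i"
definition X where "X = rms m (\<lambda>i. norm (err i))"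
definition C where "C = \<tau> / real m * rms m (\<lambda>i. norm (S i))"
definition C' where "C' = \<tau> / real m * norm (Z m) / s"

lemma s_bounds: "0 < s" "s \<le> 1"
proof -
  have "\<beta> ^ m < 1" using beta m_pos by (simp add: power_less_one_iff)
  thus "0 < s" "s \<le> 1" using beta by (simp_all add: s_def)
qed

lemma tau_pos: "0 < \<tau>"
  using m_pos a_pos beta by (simp add: \<tau>_def)

lemma tau_over_m: "\<tau> / real m = a / (1 - \<beta>)"
  using m_pos by (simp add: \<tau>_def)

text \<open>The step-size bound in the form used from here on: it makes every feedback through the
  drift a fraction of the contraction \<open>s\<close>.\<close>

lemma L_tau_le: "L * \<tau> \<le> s / 4"
proof -
  have "4 * L * real m * a \<le> (1 - \<beta>) * s"
    using a_le L_pos m_pos by (simp add: s_def field_simps)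
  thus ?thesis using beta by (simp add: \<tau>_def field_simps)
qed

lemma eta: "0 \<le> \<mu> * (1 - \<beta>)" "\<mu> * (1 - \<beta>) \<le> 1"
proof -
  show "0 \<le> \<mu> * (1 - \<beta>)" using mu beta by simp
  have "\<mu> * (1 - \<beta>) \<le> \<beta>" using mu beta by (simp add: field_simps)
  thus "\<mu> * (1 - \<beta>) \<le> 1" using beta by simp
qed

lemma convolution_Suc:
  fixes h :: "nat \<Rightarrow> 'a"
  shows "(\<Sum>j<Suc i. \<beta> ^ (Suc i - 1 - j) *\<^sub>R h j) = \<beta> *\<^sub>R (\<Sum>j<i. \<beta> ^ (i - 1 - j) *\<^sub>R h j) + h i"
proof -
  have "\<beta> ^ (i - j) = \<beta> * \<beta> ^ (i - 1 - j)" if "j < i" for j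
  proof -
    have "i - j = Suc (i - 1 - j)" using that by simp
    thus ?thesis by simp
  qed
  thus ?thesis by (simp add: scaleR_sum_right)
qed

lemma v_closed: "i \<le> m \<Longrightarrow> v i = \<beta> ^ i *\<^sub>R v 0 - a *\<^sub>R (\<Sum>j<i. \<beta> ^ (i - 1 - j) *\<^sub>R d j)"
proof (induction i)
  case (Suc i)
  thus ?case
    unfolding convolution_Suc by (simp add: v_Suc scaleR_right_diff_distrib scaleR_right_distrib mult.commute)
qed simp

lemma z_closed: "i \<le> m \<Longrightarrow> z i = z 0 - (a / (1 - \<beta>)) *\<^sub>R (\<Sum>j<i. d j)"
  by (induction i) (simp_all add: z_Suc scaleR_right_distrib)

text \<open>Summation by parts: it exposes the partial sums of the zero-sum noise, which are
  smaller than the weighted sums suggest.\<close>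
lemma Z_eq: "Z i = R i - (1 - \<beta>) *\<^sub>R (\<Sum>j<i. \<beta> ^ (i - 1 - j) *\<^sub>R R j)"
proof (induction i)
  case (Suc i)
  have "Z (Suc i) = \<beta> *\<^sub>R Z i + r i" unfolding Z_def convolution_Suc ..
  also have "\<dots> = R (Suc i) - (1 - \<beta>) *\<^sub>R (\<beta> *\<^sub>R (\<Sum>j<i. \<beta> ^ (i - 1 - j) *\<^sub>R R j) + R i)"
    unfolding Suc by (simp add: R_def algebra_simps)
  finally show ?case unfolding convolution_Suc .
qed (simp add: Z_def R_def)

text \<open>Both recursions unroll to sums over the same \<open>d j\<close>. Since
  \<open>a = (1 - \<beta>) * (\<tau> / m)\<close>, the velocity part only subtracts from the
  position part, and the combined weights stay between 0 and 1.\<close>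

lemma err_eq:
  assumes "i \<le> m"
  shows "err i = - (\<mu> * \<beta> ^ i) *\<^sub>R v 0 - (\<tau> / real m) *\<^sub>R
    (\<Sum>j<i. (1 - \<mu> * (1 - \<beta>) * \<beta> ^ (i - 1 - j)) *\<^sub>R d j)"
proof -
  have "\<mu> *\<^sub>R (a *\<^sub>R (\<Sum>j<i. \<beta> ^ (i - 1 - j) *\<^sub>R d j))
      = (a / (1 - \<beta>)) *\<^sub>R (\<Sum>j<i. (\<mu> * (1 - \<beta>) * \<beta> ^ (i - 1 - j)) *\<^sub>R d j)"
    unfolding scaleR_sum_right scaleR_scaleR using beta
    by (intro sum.cong arg_cong2[where f=scaleR] refl) simp
  thus ?thesis
    unfolding err_def tau_over_m v_closed[OF assms] z_closed[OF assms]
    by (simp add: scaleR_left_diff_distrib sum_subtractf scaleR_right_diff_distrib)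
qed

text \<open>Splitting \<open>d j\<close> into \<open>G\<close>, \<open>r j\<close> and the drift
  error separates the four contributions. The last one involves only earlier drifts, so this is a
  discrete Volterra inequality.\<close>

lemma norm_err_le:
  assumes i: "i < m"
  shows "norm (err i) \<le> norm (u 0) + \<tau> * norm G * (real i / real m)
    + \<tau> / real m * norm (S i) + L * \<tau> * ((\<Sum>j<i. norm (err j)) / real m)"
proof -
  define \<omega> where "\<omega> j = 1 - \<mu> * (1 - \<beta>) * \<beta> ^ (i - 1 - j)" for j
  have w: "0 \<le> \<omega> j" "\<omega> j \<le> 1" for j
  proof -
    have "0 \<le> \<beta> ^ (i - 1 - j)" "\<beta> ^ (i - 1 - j) \<le> 1" using beta by (simp_all add: power_le_one)
    thus "0 \<le> \<omega> j" "\<omega> j \<le> 1" using eta mult_mono[OF eta(2), of "\<beta> ^ (i - 1 - j)" 1]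
      by (simp_all add: \<omega>_def)
  qed
  have dj: "d j = G + r j + (d j - G - r j)" for j by simp
  have S: "(\<Sum>j<i. \<omega> j *\<^sub>R r j) = S i"
    by (simp add: S_def R_def Z_def \<omega>_def scaleR_left_diff_distrib sum_subtractf scaleR_sum_right)
  have "(\<Sum>j<i. \<omega> j *\<^sub>R d j) = (\<Sum>j<i. \<omega> j *\<^sub>R G + \<omega> j *\<^sub>R r j + \<omega> j *\<^sub>R (d j - G - r j))"
    by (intro sum.cong refl, subst dj) (simp only: scaleR_right_distrib)
  also have "\<dots> = (\<Sum>j<i. \<omega> j *\<^sub>R G) + S i + (\<Sum>j<i. \<omega> j *\<^sub>R (d j - G - r j))"
    by (simp only: sum.distrib S)
  finally have eq: "(\<Sum>j<i. \<omega> j *\<^sub>R d j) = (\<Sum>j<i. \<omega> j *\<^sub>R G) + S i + (\<Sum>j<i. \<omega> j *\<^sub>R (d j - G - r j))" .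
  have 1: "norm (\<Sum>j<i. \<omega> j *\<^sub>R G) \<le> real i * norm G"
  proof -
    have "norm (\<Sum>j<i. \<omega> j *\<^sub>R G) \<le> (\<Sum>j<i. norm G)"
      using w by (intro sum_norm_le) (auto intro: mult_left_le_one_le)
    thus ?thesis by simp
  qed
  have 2: "norm (\<Sum>j<i. \<omega> j *\<^sub>R (d j - G - r j)) \<le> L * (\<Sum>j<i. norm (err j))"
    unfolding sum_distrib_left
  proof (rule sum_norm_le)
    fix j assume "j \<in> {..<i}"
    hence "j < m" using i by simp
    have "norm (\<omega> j *\<^sub>R (d j - G - r j)) \<le> norm (d j - G - r j)"
      using w[of j] by (auto intro: mult_left_le_one_le)
    also have "\<dots> \<le> L * norm (err j)" using d_err[OF \<open>j < m\<close>] by (simp add: err_def)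
    finally show "norm (\<omega> j *\<^sub>R (d j - G - r j)) \<le> L * norm (err j)" .
  qed
  have 3: "norm ((\<mu> * \<beta> ^ i) *\<^sub>R v 0) \<le> norm (u 0)"
  proof -
    have "\<mu> * \<beta> ^ i \<le> \<beta> / (1 - \<beta>) * 1"
      using beta mu by (intro mult_mono) (auto simp: power_le_one)
    hence "\<mu> * \<beta> ^ i * norm (v 0) \<le> \<beta> / (1 - \<beta>) * norm (v 0)"
      by (intro mult_right_mono) auto
    thus ?thesis using mu beta by (simp add: u_def abs_mult)
  qed
  have "norm (err i) \<le> norm ((\<mu> * \<beta> ^ i) *\<^sub>R v 0) + \<tau> / real m * norm (\<Sum>j<i. \<omega> j *\<^sub>R d j)"
  proof -
    have "err i = - ((\<mu> * \<beta> ^ i) *\<^sub>R v 0 + (\<tau> / real m) *\<^sub>R (\<Sum>j<i. \<omega> j *\<^sub>R d j))"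
      using err_eq[of i] i by (simp add: \<omega>_def)
    hence "norm (err i) = norm ((\<mu> * \<beta> ^ i) *\<^sub>R v 0 + (\<tau> / real m) *\<^sub>R (\<Sum>j<i. \<omega> j *\<^sub>R d j))"
      by (simp only: norm_minus_cancel)
    also have "\<dots> \<le> norm ((\<mu> * \<beta> ^ i) *\<^sub>R v 0) + norm ((\<tau> / real m) *\<^sub>R (\<Sum>j<i. \<omega> j *\<^sub>R d j))"
      by (rule norm_triangle_ineq)
    finally show ?thesis using tau_pos by simp
  qed
  also have "\<dots> \<le> norm (u 0) + \<tau> / real m * (real i * norm G + norm (S i) + L * (\<Sum>j<i. norm (err j)))"
  proof (intro add_mono 3 mult_left_mono)
    show "norm (\<Sum>j<i. \<omega> j *\<^sub>R d j) \<le> real i * norm G + norm (S i) + L * (\<Sum>j<i. norm (err j))"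
      unfolding eq by (intro norm_triangle_le add_mono 1 2 order_refl)
  qed (use tau_pos in simp)
  finally show ?thesis by (simp add: algebra_simps)
qed

lemma X_le: "X \<le> norm (u 0) + 3 / 5 * (\<tau> * norm G) + C + 5 / 7 * (L * \<tau>) * X"
proof -
  have "X \<le> rms m (\<lambda>i. norm (u 0) + \<tau> * norm G * (real i / real m)
    + \<tau> / real m * norm (S i) + L * \<tau> * ((\<Sum>j<i. norm (err j)) / real m))"
    unfolding X_def by (intro rms_mono norm_err_le) auto
  also have "\<dots> \<le> rms m (\<lambda>i. norm (u 0)) + rms m (\<lambda>i. \<tau> * norm G * (real i / real m))
    + rms m (\<lambda>i. \<tau> / real m * norm (S i)) + rms m (\<lambda>i. L * \<tau> * ((\<Sum>j<i. norm (err j)) / real m))"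
    by (intro order_trans[OF rms_add_le] add_mono order_refl)
  also have "\<dots> = norm (u 0) + \<tau> * norm G * rms m (\<lambda>i. real i / real m)
    + C + L * \<tau> * rms m (\<lambda>i. (\<Sum>j<i. norm (err j)) / real m)"
    unfolding C_def using m_pos tau_pos L_pos
    by (intro arg_cong2[where f="(+)"] rms_const rms_cmult) auto
  also have "\<dots> \<le> norm (u 0) + \<tau> * norm G * (3 / 5) + C + L * \<tau> * (5 / 7 * X)"
    unfolding X_def using m_pos tau_pos L_pos
    by (intro add_mono mult_left_mono rms_index_le rms_partial_average_le order_refl) auto
  finally show ?thesis by (simp add: algebra_simps)
qed

lemma X_nonneg: "0 \<le> X" by (simp add: X_def rms_nonneg)

text \<open>As \<open>L * \<tau> \<le> s / 4\<close>, the feedback coefficient 5/7 becomes 5/28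
  times \<open>s\<close> and moves to the left-hand side.\<close>

lemma X_absorbed: "(1 - 5 / 28 * s) * X \<le> norm (u 0) + 3 / 5 * (\<tau> * norm G) + C"
proof -
  have "5 / 7 * (L * \<tau>) * X \<le> 5 / 7 * (s / 4) * X"
    using L_tau_le X_nonneg by (intro mult_right_mono) auto
  thus ?thesis using X_le by (simp add: algebra_simps)
qed

text \<open>The old \<open>u\<close> shrinks by \<open>\<beta> ^ m = 1 - s\<close>, and the mean
  weight of \<open>G\<close> is at most \<open>1 - s / 2\<close>. The drift feeds back at most
  \<open>s / 4\<close> times the bound of \<open>X_absorbed\<close>, which turns these factors into
  \<open>1 - 3 / 4 * s\<close> and \<open>1 - 7 / 20 * s\<close>.\<close>

lemma norm_u_le:
  "norm (u m) \<le> (1 - 3 / 4 * s) * norm (u 0) + (1 - 7 / 20 * s) * (\<tau> * norm G) + s * (C' + C / 4)"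
proof -
  define \<kappa> where "\<kappa> = (\<Sum>j<m. \<beta> ^ (m - j)) / real m"
  have kappa0: "0 \<le> \<kappa>" using beta by (auto simp: \<kappa>_def intro!: divide_nonneg_nonneg sum_nonneg)
  have kappa: "\<kappa> \<le> 1 - s / 2"
  proof -
    have "\<kappa> \<le> (real m * (1 + \<beta> ^ m) / 2) / real m"
      unfolding \<kappa>_def using beta by (intro divide_right_mono sum_power_le_trapezoid) auto
    also have "\<dots> = 1 - s / 2" using m_pos by (simp add: s_def field_simps)
    finally show ?thesis .
  qed
  have pw: "\<beta> * \<beta> ^ (m - 1 - j) = \<beta> ^ (m - j)" if "j < m" for j
  proof -
    have "m - j = Suc (m - 1 - j)" using that by simp
    thus ?thesis by simp
  qed
  have dj: "d j = G + r j + (d j - G - r j)" for j by simp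
  have "\<beta> *\<^sub>R (\<Sum>j<m. \<beta> ^ (m - 1 - j) *\<^sub>R d j)
      = (\<Sum>j<m. \<beta> ^ (m - j) *\<^sub>R G + \<beta> *\<^sub>R \<beta> ^ (m - 1 - j) *\<^sub>R r j + \<beta> ^ (m - j) *\<^sub>R (d j - G - r j))"
    unfolding scaleR_sum_right
  proof (intro sum.cong refl)
    fix j assume "j \<in> {..<m}"
    thus "\<beta> *\<^sub>R \<beta> ^ (m - 1 - j) *\<^sub>R d j
      = \<beta> ^ (m - j) *\<^sub>R G + \<beta> *\<^sub>R \<beta> ^ (m - 1 - j) *\<^sub>R r j + \<beta> ^ (m - j) *\<^sub>R (d j - G - r j)"
      by (subst dj) (simp only: scaleR_right_distrib scaleR_scaleR pw lessThan_iff)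
  qed
  also have "\<dots> = (real m * \<kappa>) *\<^sub>R G + \<beta> *\<^sub>R Z m + (\<Sum>j<m. \<beta> ^ (m - j) *\<^sub>R (d j - G - r j))"
    using m_pos by (simp add: sum.distrib \<kappa>_def Z_def scaleR_sum_right scaleR_sum_left)
  finally have eq: "\<beta> *\<^sub>R (\<Sum>j<m. \<beta> ^ (m - 1 - j) *\<^sub>R d j)
    = (real m * \<kappa>) *\<^sub>R G + \<beta> *\<^sub>R Z m + (\<Sum>j<m. \<beta> ^ (m - j) *\<^sub>R (d j - G - r j))" .
  have e: "norm (\<Sum>j<m. \<beta> ^ (m - j) *\<^sub>R (d j - G - r j)) \<le> L * (real m * ((1 - s / 4) * X))"
  proof -
    have "norm (\<Sum>j<m. \<beta> ^ (m - j) *\<^sub>R (d j - G - r j)) \<le> (\<Sum>j<m. \<beta> ^ (m - j) * (L * norm (err j)))"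
      using beta d_err by (intro sum_norm_le) (auto simp: err_def intro!: mult_left_mono)
    also have "\<dots> = L * (\<Sum>j<m. \<beta> ^ (m - j) * norm (err j))"
      by (simp add: sum_distrib_left mult.left_commute)
    also have "\<dots> \<le> L * (real m * ((1 - s / 4) * X))"
    \<comment> \<open>The weighted Cauchy-Schwarz bound is
      \<open>(real m)\<^sup>2 * (\<kappa> * X\<^sup>2)\<close>, and the square root of \<kappa> is
      at most \<open>1 - s / 4\<close>.\<close>
    proof (rule mult_left_mono, rule power2_le_imp_le)
      have "(\<Sum>j<m. \<beta> ^ (m - j) * norm (err j))\<^sup>2
          \<le> (\<Sum>j<m. \<beta> ^ (m - j)) * (\<Sum>j<m. \<beta> ^ (m - j) * (norm (err j))\<^sup>2)"
        using norm_sum_scaleR_sq_le[of "{..<m}" "\<lambda>j. \<beta> ^ (m - j)" "\<lambda>j. norm (err j)"] beta by simp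
      also have "\<dots> \<le> (\<Sum>j<m. \<beta> ^ (m - j)) * (\<Sum>j<m. (norm (err j))\<^sup>2)"
        using beta by (intro mult_left_mono sum_mono sum_nonneg mult_left_le_one_le power_le_one) simp_all
      also have "\<dots> = (real m)\<^sup>2 * (\<kappa> * X\<^sup>2)"
        unfolding X_def rms_sq \<kappa>_def using m_pos by (simp add: power2_eq_square)
      also have "\<dots> \<le> (real m)\<^sup>2 * ((1 - s / 4)\<^sup>2 * X\<^sup>2)"
      proof (intro mult_left_mono mult_right_mono)
        have "(1 - s / 4)\<^sup>2 = 1 - s / 2 + (s / 4)\<^sup>2" by (simp add: power2_eq_square algebra_simps)
        thus "\<kappa> \<le> (1 - s / 4)\<^sup>2" using kappa zero_le_power2[of "s / 4"] by linarith
      qed auto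
      finally show "(\<Sum>j<m. \<beta> ^ (m - j) * norm (err j))\<^sup>2 \<le> (real m * ((1 - s / 4) * X))\<^sup>2"
        by (simp add: power_mult_distrib)
      show "0 \<le> real m * ((1 - s / 4) * X)" using s_bounds X_nonneg by simp
    qed (use L_pos in simp)
    finally show ?thesis .
  qed
  have ueq: "u m = \<beta> ^ m *\<^sub>R u 0 - (\<tau> / real m) *\<^sub>R (\<beta> *\<^sub>R (\<Sum>j<m. \<beta> ^ (m - 1 - j) *\<^sub>R d j))"
    unfolding u_def tau_over_m by (subst v_closed) (simp_all add: scaleR_right_diff_distrib mult.commute)
  have "norm (u m) \<le> \<beta> ^ m * norm (u 0)
      + \<tau> / real m * norm (\<beta> *\<^sub>R (\<Sum>j<m. \<beta> ^ (m - 1 - j) *\<^sub>R d j))"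
    unfolding ueq using beta tau_pos by (intro order_trans[OF norm_triangle_ineq4]) simp
  also have "\<dots> \<le> \<beta> ^ m * norm (u 0)
      + \<tau> / real m * (real m * \<kappa> * norm G + norm (Z m) + L * (real m * ((1 - s / 4) * X)))"
  proof (rule add_left_mono, rule mult_left_mono)
    have "norm ((real m * \<kappa>) *\<^sub>R G) \<le> real m * \<kappa> * norm G" using kappa0 by simp
    moreover have "norm (\<beta> *\<^sub>R Z m) \<le> norm (Z m)"
      using beta by (simp add: mult_left_le_one_le)
    ultimately show "norm (\<beta> *\<^sub>R (\<Sum>j<m. \<beta> ^ (m - 1 - j) *\<^sub>R d j))
      \<le> real m * \<kappa> * norm G + norm (Z m) + L * (real m * ((1 - s / 4) * X))"
      unfolding eq by (intro norm_triangle_le add_mono e)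
  qed (use tau_pos in simp)
  also have "\<dots> = (1 - s) * norm (u 0) + \<kappa> * (\<tau> * norm G) + s * C' + L * \<tau> * ((1 - s / 4) * X)"
  proof -
    have "\<tau> / real m * norm (Z m) = s * C'" using s_bounds by (simp add: C'_def)
    moreover have "\<tau> / real m * (real m * \<kappa> * norm G) = \<kappa> * (\<tau> * norm G)" using m_pos by simp
    moreover have "\<tau> / real m * (L * (real m * ((1 - s / 4) * X))) = L * \<tau> * ((1 - s / 4) * X)"
      using m_pos by simp
    moreover have "\<beta> ^ m = 1 - s" by (simp add: s_def)
    ultimately show ?thesis by (simp only: distrib_left add.assoc)
  qed
  also have "\<dots> \<le> (1 - s) * norm (u 0) + (1 - s / 2) * (\<tau> * norm G) + s * C'
      + s / 4 * (norm (u 0) + 3 / 5 * (\<tau> * norm G) + C)"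
  proof -
    \<comment> \<open>Because 5/28 is below 1/4, the factor gained from the geometric weights makes
      up for the loss in \<open>X_absorbed\<close>.\<close>
    have "L * \<tau> * ((1 - s / 4) * X) \<le> s / 4 * ((1 - 5 / 28 * s) * X)"
    proof (rule mult_mono[OF L_tau_le])
      show "(1 - s / 4) * X \<le> (1 - 5 / 28 * s) * X"
        using s_bounds X_nonneg by (intro mult_right_mono) auto
    qed (use s_bounds X_nonneg in auto)
    also have "\<dots> \<le> s / 4 * (norm (u 0) + 3 / 5 * (\<tau> * norm G) + C)"
      using X_absorbed s_bounds by (intro mult_left_mono) auto
    finally have "L * \<tau> * ((1 - s / 4) * X) \<le> s / 4 * (norm (u 0) + 3 / 5 * (\<tau> * norm G) + C)" .
    moreover have "\<kappa> * (\<tau> * norm G) \<le> (1 - s / 2) * (\<tau> * norm G)"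
      using kappa tau_pos by (intro mult_right_mono) auto
    ultimately show ?thesis by linarith
  qed
  also have "\<dots> = (1 - 3 / 4 * s) * norm (u 0) + (1 - 7 / 20 * s) * (\<tau> * norm G) + s * (C' + C / 4)"
    by (simp add: algebra_simps)
  finally show ?thesis .
qed

end

section \<open>Lyapunov descent over one epoch\<close>

text \<open>The gap in Jensen's inequality is the variance, written as a weighted sum of squared
  pairwise differences.\<close>

lemma convex_sq3:
  fixes p q r :: real
  assumes "0 \<le> w1" "0 \<le> w2" "0 \<le> w3" "w1 + w2 + w3 = 1"
  shows "(w1 * p + w2 * q + w3 * r)\<^sup>2 \<le> w1 * p\<^sup>2 + w2 * q\<^sup>2 + w3 * r\<^sup>2"
proof -
  have w3: "w3 = 1 - w1 - w2" using assms by simp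
  have "0 \<le> w1 * w2 * (p - q)\<^sup>2 + w1 * w3 * (p - r)\<^sup>2 + w2 * w3 * (q - r)\<^sup>2"
    using assms by (intro add_nonneg_nonneg mult_nonneg_nonneg) auto
  also have "\<dots> = w1 * p\<^sup>2 + w2 * q\<^sup>2 + w3 * r\<^sup>2 - (w1 * p + w2 * q + w3 * r)\<^sup>2"
    unfolding w3 by algebra
  finally show ?thesis by simp
qed

text \<open>The constants 7/4, 28/23 and the convex weights are tuned so that the final bound
  holds with coefficients 1/8, 6 and 5; there is little slack.\<close>
lemma lyapunov_arithmetic:
  fixes A B C C' X U s :: real
  assumes s: "0 < s" "s \<le> 1" and nn: "0 \<le> A" "0 \<le> B" "0 \<le> C" "0 \<le> C'" "0 \<le> X" "0 \<le> U"
    and X: "(1 - 5 / 28 * s) * X \<le> A + 3 / 5 * B + C"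
    and U: "U \<le> (1 - 3 / 4 * s) * A + (1 - 7 / 20 * s) * B + s * (C' + C / 4)"
  shows "X\<^sup>2 / 2 + 7 / 4 / s * U\<^sup>2
    \<le> (7 / 4 / s - 1 / 8) * A\<^sup>2 + 6 * (B\<^sup>2 / s\<^sup>2) + 5 * ((C'\<^sup>2 + C\<^sup>2) / s\<^sup>2)"
proof -
  have s2: "0 < s\<^sup>2" "s\<^sup>2 \<le> 1" using s by (auto simp: power_le_one)
  have "23 / 28 * X \<le> (1 - 5 / 28 * s) * X" using s nn by (intro mult_right_mono) auto
  hence "X \<le> 28 / 23 * (A + 3 / 5 * B + C)" using X by simp
  hence "X\<^sup>2 \<le> (28 / 23 * (A + 3 / 5 * B + C))\<^sup>2" using nn by (intro power_mono) auto
  \<comment> \<open>The weights 5/8, 1/6, 5/24 add up to 1. The factor 28/23 is the inverse of 1 -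
    5/28, from \<open>s \<le> 1\<close>.\<close>
  also have "\<dots> = (28 / 23)\<^sup>2 * (5 / 8 * (8 / 5 * A) + 1 / 6 * (18 / 5 * B) + 5 / 24 * (24 / 5 * C))\<^sup>2"
    unfolding power_mult_distrib by simp
  also have "\<dots> \<le> (28 / 23)\<^sup>2 * (5 / 8 * (8 / 5 * A)\<^sup>2 + 1 / 6 * (18 / 5 * B)\<^sup>2 + 5 / 24 * (24 / 5 * C)\<^sup>2)"
    by (intro mult_left_mono convex_sq3) auto
  also have "\<dots> = 784 / 529 * (8 / 5 * A\<^sup>2 + 54 / 25 * B\<^sup>2 + 24 / 5 * C\<^sup>2)"
    by (simp add: power_mult_distrib power_divide)
  finally have X2: "X\<^sup>2 / 2 \<le> 392 / 529 * (8 / 5 * A\<^sup>2 + 54 / 25 * B\<^sup>2 + 24 / 5 * C\<^sup>2)" by simp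
  \<comment> \<open>\<open>w1\<close> is the coefficient of \<open>A\<close> in the bound on
    \<open>U\<close>, so \<open>A\<close> enters the square with no extra factor. The remaining mass
    \<open>3 / 4 * s\<close> is split so that \<open>w2\<close> contains \<open>20 - 11 * s\<close>,
    which cancels in \<open>e2\<close> because
    \<open>(1 - 7 / 20 * s)\<^sup>2 \<le> (20 - 11 * s) / 20\<close>.\<close>
  define w1 where "w1 = 1 - 3 / 4 * s"
  define w2 where "w2 = s * (20 - 11 * s) / 50"
  define w3 where "w3 = s * (35 + 22 * s) / 100"
  have w: "0 < w1" "0 < w2" "0 < w3" "w1 + w2 + w3 = 1"
    using s by (auto simp: w1_def w2_def w3_def intro!: mult_pos_pos) (simp add: field_simps)
  define E where "E = (1 - 7 / 20 * s) * B"
  define N where "N = C' + C / 4"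
  have "U\<^sup>2 \<le> (w1 * A + w2 * (E / w2) + w3 * (s * N / w3))\<^sup>2"
    using U nn w by (intro power_mono) (auto simp: w1_def E_def N_def)
  also have "\<dots> \<le> w1 * A\<^sup>2 + w2 * (E / w2)\<^sup>2 + w3 * (s * N / w3)\<^sup>2"
    using w by (intro convex_sq3) auto
  also have "\<dots> = w1 * A\<^sup>2 + E\<^sup>2 / w2 + s\<^sup>2 * N\<^sup>2 / w3"
    using w by (simp add: power2_eq_square)
  finally have "7 / 4 / s * U\<^sup>2 \<le> 7 / 4 / s * (w1 * A\<^sup>2 + E\<^sup>2 / w2 + s\<^sup>2 * N\<^sup>2 / w3)"
    using s by (intro mult_left_mono) auto
  hence U2: "7 / 4 / s * U\<^sup>2 \<le> 7 / 4 / s * (w1 * A\<^sup>2) + 7 / 4 * (E\<^sup>2 / (s * w2)) + 7 / 4 * (s * N\<^sup>2 / w3)"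
    using s by (simp add: distrib_left power2_eq_square)
  have e1: "7 / 4 / s * (w1 * A\<^sup>2) = 7 / 4 / s * A\<^sup>2 - 21 / 16 * A\<^sup>2"
    using s by (simp add: w1_def field_simps)
  have e2: "E\<^sup>2 / (s * w2) \<le> 5 / 2 * (B\<^sup>2 / s\<^sup>2)"
  proof -
    have "49 / 400 * s * s \<le> 3 / 20 * s" using s mult_right_mono[of s 1 s] by simp
    hence "(1 - 7 / 20 * s)\<^sup>2 \<le> (20 - 11 * s) / 20"
      by (simp add: power2_eq_square algebra_simps)
    hence "(1 - 7 / 20 * s)\<^sup>2 * B\<^sup>2 \<le> (20 - 11 * s) / 20 * B\<^sup>2" by (intro mult_right_mono) auto
    hence "E\<^sup>2 \<le> (20 - 11 * s) / 20 * B\<^sup>2" by (simp add: E_def power_mult_distrib)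
    hence "E\<^sup>2 / (s * w2) \<le> ((20 - 11 * s) / 20 * B\<^sup>2) / (s * w2)"
      using w s by (intro divide_right_mono) auto
    also have "\<dots> = 5 / 2 * (B\<^sup>2 / s\<^sup>2)"
      using s by (simp add: w2_def power2_eq_square divide_simps)
    finally show ?thesis .
  qed
  have e3: "s * N\<^sup>2 / w3 \<le> 125 / 57 * ((C'\<^sup>2 + C\<^sup>2 / 4) / s\<^sup>2)"
  proof -
    have N2: "N\<^sup>2 \<le> 5 / 4 * (C'\<^sup>2 + C\<^sup>2 / 4)"
    proof -
      have "5 / 4 * (C'\<^sup>2 + C\<^sup>2 / 4) - N\<^sup>2 = (C' - C)\<^sup>2 / 4"
        by (simp add: N_def power2_eq_square field_simps)
      thus ?thesis using zero_le_power2[of "C' - C"] by linarith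
    qed
    have "s * s \<le> s" using s mult_right_mono[of s 1 s] by simp
    hence "57 * s\<^sup>2 \<le> 35 + 22 * s" unfolding power2_eq_square using s by linarith
    hence "s / w3 \<le> 100 / (57 * s\<^sup>2)"
      using s by (simp add: w3_def divide_simps)
    hence "s / w3 * N\<^sup>2 \<le> 100 / (57 * s\<^sup>2) * (5 / 4 * (C'\<^sup>2 + C\<^sup>2 / 4))"
      using N2 s by (intro mult_mono) auto
    moreover have "100 / (57 * s\<^sup>2) * (5 / 4 * Y) = 125 / 57 * (Y / s\<^sup>2)" for Y by simp
    ultimately show ?thesis by (simp only: times_divide_eq_left)
  qed
  have h: "C\<^sup>2 \<le> C\<^sup>2 / s\<^sup>2" "B\<^sup>2 \<le> B\<^sup>2 / s\<^sup>2"
    using s2 by (simp_all add: le_divide_eq mult_left_le)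
  have h3: "0 \<le> C'\<^sup>2 / s\<^sup>2" "0 \<le> C\<^sup>2 / s\<^sup>2" "0 \<le> B\<^sup>2 / s\<^sup>2" "0 \<le> A\<^sup>2" using s2 by auto
  have f1: "(C'\<^sup>2 + C\<^sup>2 / 4) / s\<^sup>2 = C'\<^sup>2 / s\<^sup>2 + (C\<^sup>2 / s\<^sup>2) / 4"
    "(C'\<^sup>2 + C\<^sup>2) / s\<^sup>2 = C'\<^sup>2 / s\<^sup>2 + C\<^sup>2 / s\<^sup>2" by (simp_all add: add_divide_distrib)
  have l: "(7 / 4 / s - 1 / 8) * A\<^sup>2 = 7 / 4 / s * A\<^sup>2 - A\<^sup>2 / 8" by (simp add: left_diff_distrib)
  \<comment> \<open>Collecting terms gives about -0.127 against -1/8 for \<open>A\<^sup>2\<close>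
    and 5.976 against 6 for \<open>B\<^sup>2 / s\<^sup>2\<close>; the noise coefficients stay
    clearly below 5.\<close>
  show ?thesis
    using X2 U2 e2 e3 h h3 unfolding e1 f1 l by argo
qed

section \<open>Weights of the partial sums in the noise bound\<close>

text \<open>These weights do not depend on the permutation, so the noise of an epoch can be averaged
  term by term over all permutations.\<close>
definition noise_kernel :: "real \<Rightarrow> real \<Rightarrow> nat \<Rightarrow> nat \<Rightarrow> real" where
  "noise_kernel \<beta> \<eta> i j =
    (if j = i then 1 - \<eta> else 0) + (if j < i then \<eta> * (1 - \<beta>) * \<beta> ^ (i - 1 - j) else 0)"

text \<open>The first summand is the share of \<open>C\<close>, the kernel averaged over the inner
  steps; the second is the share of \<open>C'\<close>. Each has total mass at most 1.\<close>

definition noise_weight :: "nat \<Rightarrow> real \<Rightarrow> real \<Rightarrow> nat \<Rightarrow> real" where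
  "noise_weight m \<beta> \<eta> j =
    (\<Sum>i<m. noise_kernel \<beta> \<eta> i j) / real m + (1 - \<beta>) * \<beta> ^ (m - 1 - j) / (1 - \<beta> ^ m)"

text \<open>For \<open>h = R\<close> and \<open>\<eta> = \<mu> * (1 - \<beta>)\<close> the
  right-hand side is \<open>S i\<close> after the summation by parts in \<open>Z_eq\<close>.\<close>

lemma sum_noise_kernel:
  fixes h :: "nat \<Rightarrow> 'b::real_vector"
  assumes "i < m"
  shows "(\<Sum>j<m. noise_kernel \<beta> \<eta> i j *\<^sub>R h j)
    = (1 - \<eta>) *\<^sub>R h i + (\<eta> * (1 - \<beta>)) *\<^sub>R (\<Sum>j<i. \<beta> ^ (i - 1 - j) *\<^sub>R h j)"
proof -
  have "(\<Sum>j<m. noise_kernel \<beta> \<eta> i j *\<^sub>R h j)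
      = (\<Sum>j<m. (if j = i then (1 - \<eta>) *\<^sub>R h j else 0)
          + (if j < i then (\<eta> * (1 - \<beta>) * \<beta> ^ (i - 1 - j)) *\<^sub>R h j else 0))"
    by (intro sum.cong) (auto simp: noise_kernel_def)
  also have "\<dots> = (1 - \<eta>) *\<^sub>R h i + (\<Sum>j\<in>{j\<in>{..<m}. j < i}. (\<eta> * (1 - \<beta>) * \<beta> ^ (i - 1 - j)) *\<^sub>R h j)"
    using assms by (subst sum.inter_filter) (simp_all add: sum.distrib)
  also have "{j\<in>{..<m}. j < i} = {..<i}" using assms by auto
  finally show ?thesis by (simp add: scaleR_sum_right)
qed

lemma noise_kernel_nonneg:
  assumes "0 \<le> \<beta>" "\<beta> < 1" "0 \<le> \<eta>" "\<eta> \<le> 1"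
  shows "0 \<le> noise_kernel \<beta> \<eta> i j"
  using assms by (simp add: noise_kernel_def)

lemma sum_noise_kernel_le:
  assumes "0 \<le> \<beta>" "\<beta> < 1" "0 \<le> \<eta>" "\<eta> \<le> 1" "i < m"
  shows "(\<Sum>j<m. noise_kernel \<beta> \<eta> i j) \<le> 1"
proof -
  have "(\<Sum>j<m. noise_kernel \<beta> \<eta> i j) = 1 - \<eta> + \<eta> * ((1 - \<beta>) * (\<Sum>j<i. \<beta> ^ (i - 1 - j)))"
    using sum_noise_kernel[OF assms(5), of \<beta> \<eta> "\<lambda>_. 1::real"] by simp
  also have "\<dots> = 1 - \<eta> * \<beta> ^ i" unfolding sum_geometric_reversed by (simp add: algebra_simps)
  finally show ?thesis using assms by simp
qed

lemma noise_weight_nonneg: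
  assumes "0 \<le> \<beta>" "\<beta> < 1" "0 \<le> \<eta>" "\<eta> \<le> 1"
  shows "0 \<le> noise_weight m \<beta> \<eta> j"
  unfolding noise_weight_def using assms
  by (intro add_nonneg_nonneg divide_nonneg_nonneg sum_nonneg noise_kernel_nonneg mult_nonneg_nonneg)
     (auto simp: power_le_one)

lemma sum_noise_weight_le:
  assumes "0 \<le> \<beta>" "\<beta> < 1" "0 \<le> \<eta>" "\<eta> \<le> 1" "0 < m"
  shows "(\<Sum>j<m. noise_weight m \<beta> \<eta> j) \<le> 2"
proof -
  have "\<beta> ^ m < 1" using assms by (simp add: power_less_one_iff)
  have "(\<Sum>j<m. \<Sum>i<m. noise_kernel \<beta> \<eta> i j) = (\<Sum>i<m. \<Sum>j<m. noise_kernel \<beta> \<eta> i j)"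
    by (rule sum.swap)
  also have "\<dots> \<le> (\<Sum>i<m. 1)" using assms by (intro sum_mono sum_noise_kernel_le) auto
  finally have "(\<Sum>j<m. \<Sum>i<m. noise_kernel \<beta> \<eta> i j) / real m \<le> 1" using assms by simp
  moreover have "(\<Sum>j<m. (1 - \<beta>) * \<beta> ^ (m - 1 - j) / (1 - \<beta> ^ m)) = 1"
    using \<open>\<beta> ^ m < 1\<close> sum_geometric_reversed[of \<beta> m]
    by (simp flip: sum_divide_distrib sum_distrib_left)
  ultimately show ?thesis
    by (simp add: noise_weight_def sum.distrib sum_divide_distrib)
qed

context rrm_epoch
begin

text \<open>Each \<open>S i\<close> combines the partial sums \<open>R j\<close> with nonnegative
  weights of total at most 1, so Jensen applies; then the two sums are exchanged.\<close>

lemma C_sq_le: "C\<^sup>2 \<le> (\<tau> / real m)\<^sup>2 * (\<Sum>j<m. (\<Sum>i<m. noise_kernel \<beta> (\<mu> * (1 - \<beta>)) i j) / real m * (norm (R j))\<^sup>2)"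
proof -
  let ?k = "noise_kernel \<beta> (\<mu> * (1 - \<beta>))"
  have "(norm (S i))\<^sup>2 \<le> (\<Sum>j<m. ?k i j * (norm (R j))\<^sup>2)" if "i < m" for i
  proof -
    have "x - e *\<^sub>R (x - c *\<^sub>R y) = (1 - e) *\<^sub>R x + (e * c) *\<^sub>R y" for x y :: 'a and e c
      by (simp add: algebra_simps)
    hence "S i = (\<Sum>j<m. ?k i j *\<^sub>R R j)"
      unfolding sum_noise_kernel[OF that] S_def Z_eq .
    hence "(norm (S i))\<^sup>2 \<le> (\<Sum>j<m. ?k i j) * (\<Sum>j<m. ?k i j * (norm (R j))\<^sup>2)"
      using beta eta by (auto intro!: norm_sum_scaleR_sq_le noise_kernel_nonneg)
    also have "\<dots> \<le> (\<Sum>j<m. ?k i j * (norm (R j))\<^sup>2)"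
      using beta eta that
      by (intro mult_left_le_one_le sum_noise_kernel_le sum_nonneg mult_nonneg_nonneg[OF noise_kernel_nonneg]
          noise_kernel_nonneg) simp_all
    finally show ?thesis .
  qed
  hence "(\<Sum>i<m. (norm (S i))\<^sup>2) \<le> (\<Sum>i<m. \<Sum>j<m. ?k i j * (norm (R j))\<^sup>2)"
    by (intro sum_mono) auto
  also have "\<dots> = (\<Sum>j<m. (\<Sum>i<m. ?k i j) * (norm (R j))\<^sup>2)"
    by (subst sum.swap) (simp add: sum_distrib_right)
  finally have "(\<Sum>i<m. (norm (S i))\<^sup>2) / real m \<le> (\<Sum>j<m. (\<Sum>i<m. ?k i j) * (norm (R j))\<^sup>2) / real m"
    by (rule divide_right_mono) simp
  also have "\<dots> = (\<Sum>j<m. (\<Sum>i<m. ?k i j) / real m * (norm (R j))\<^sup>2)"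
    by (simp add: sum_divide_distrib sum_distrib_right)
  finally have "(rms m (\<lambda>i. norm (S i)))\<^sup>2 \<le> \<dots>" unfolding rms_sq .
  thus ?thesis unfolding C_def power_mult_distrib by (intro mult_left_mono) auto
qed

text \<open>The noise sums to zero over the epoch, so \<open>R m\<close> vanishes and
  \<open>Z m\<close> is a weighted sum of earlier \<open>R j\<close>. The weights total
  \<open>s\<close>, which cancels one of the two factors \<open>s\<close> in the
  denominator.\<close>

lemma C'_sq_le: "C'\<^sup>2 \<le> (\<tau> / real m)\<^sup>2 * (\<Sum>j<m. (1 - \<beta>) * \<beta> ^ (m - 1 - j) / s * (norm (R j))\<^sup>2)"
proof -
  let ?w = "\<lambda>j. (1 - \<beta>) * \<beta> ^ (m - 1 - j)"
  have "Z m = - (\<Sum>j<m. ?w j *\<^sub>R R j)"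
    using Z_eq[of m] sum_r by (simp add: R_def scaleR_sum_right)
  hence "(norm (Z m))\<^sup>2 \<le> (\<Sum>j<m. ?w j) * (\<Sum>j<m. ?w j * (norm (R j))\<^sup>2)"
    using beta norm_sum_scaleR_sq_le[of "{..<m}" ?w R] by simp
  also have "(\<Sum>j<m. ?w j) = s"
    using sum_geometric_reversed[of \<beta> m] by (simp add: s_def sum_distrib_left)
  finally have "(norm (Z m))\<^sup>2 / s\<^sup>2 \<le> s * (\<Sum>j<m. ?w j * (norm (R j))\<^sup>2) / s\<^sup>2"
    by (rule divide_right_mono) simp
  also have "\<dots> = (\<Sum>j<m. ?w j / s * (norm (R j))\<^sup>2)"
    using s_bounds by (simp add: power2_eq_square sum_divide_distrib)
  finally have "(norm (Z m))\<^sup>2 / s\<^sup>2 \<le> \<dots>" .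
  hence "(\<tau> / real m)\<^sup>2 * ((norm (Z m))\<^sup>2 / s\<^sup>2) \<le> (\<tau> / real m)\<^sup>2 * (\<Sum>j<m. ?w j / s * (norm (R j))\<^sup>2)"
    by (intro mult_left_mono) auto
  thus ?thesis unfolding C'_def by (simp only: power_mult_distrib power_divide times_divide_eq_right)
qed

lemma noise_le:
  "C'\<^sup>2 + C\<^sup>2 \<le> (\<tau> / real m)\<^sup>2 * (\<Sum>j<m. noise_weight m \<beta> (\<mu> * (1 - \<beta>)) j * (norm (R j))\<^sup>2)"
  using C_sq_le C'_sq_le
  by (simp add: noise_weight_def s_def distrib_right sum.distrib distrib_left)

text \<open>Over the epoch \<open>z\<close> moves by -\<tau> times the mean gradient
  \<open>h\<close>. Polarisation turns the linear and quadratic terms into \<tau>/2 times the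
  difference of the squared norms of \<open>h - G\<close> and \<open>G\<close>. Since the
  \<open>r i\<close> cancel in \<open>h\<close>, only the drift remains in
  \<open>h - G\<close>.\<close>

lemma objective_descent:
  assumes f: "f1 \<le> f0 + G \<bullet> (z m - z 0) + L / 2 * (norm (z m - z 0))\<^sup>2"
  shows "f1 \<le> f0 - \<tau> / 2 * (norm G)\<^sup>2 + \<tau> / 2 * (L\<^sup>2 * X\<^sup>2)"
proof -
  define h where "h = (1 / real m) *\<^sub>R (\<Sum>i<m. d i)"
  have zm: "z m - z 0 = - (\<tau> *\<^sub>R h)"
    using z_closed[of m] m_pos by (simp add: h_def \<tau>_def)
  have "h - G = (1 / real m) *\<^sub>R (\<Sum>i<m. d i - G - r i)"
    using m_pos sum_r by (simp add: h_def sum_subtractf scaleR_right_diff_distrib sum_constant_scaleR)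
  hence "(norm (h - G))\<^sup>2 = (norm (\<Sum>i<m. d i - G - r i))\<^sup>2 / (real m)\<^sup>2"
    by (simp add: power_divide)
  also have "\<dots> \<le> (real m * (\<Sum>i<m. (norm (d i - G - r i))\<^sup>2)) / (real m)\<^sup>2"
    using norm_sum_sq_le[of "\<lambda>i. d i - G - r i" "{..<m}"] by (intro divide_right_mono) auto
  also have "\<dots> \<le> (real m * (\<Sum>i<m. (L * norm (err i))\<^sup>2)) / (real m)\<^sup>2"
    using d_err by (intro divide_right_mono mult_left_mono sum_mono power_mono) (auto simp: err_def)
  also have "\<dots> = L\<^sup>2 * X\<^sup>2"
    unfolding X_def rms_sq using m_pos
    by (simp add: power_mult_distrib sum_distrib_left[symmetric]) (simp add: power2_eq_square)
  finally have hG: "(norm (h - G))\<^sup>2 \<le> L\<^sup>2 * X\<^sup>2" .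
  have "L * \<tau> \<le> 1" using L_tau_le s_bounds by linarith
  hence "L * \<tau> * (\<tau> / 2 * (norm h)\<^sup>2) \<le> 1 * (\<tau> / 2 * (norm h)\<^sup>2)"
    using tau_pos by (intro mult_right_mono) auto
  hence 1: "L / 2 * (norm (z m - z 0))\<^sup>2 \<le> \<tau> / 2 * (norm h)\<^sup>2"
    unfolding zm by (simp add: power_mult_distrib power2_eq_square mult_ac)
  have sq: "(norm (h - G))\<^sup>2 = (norm h)\<^sup>2 - 2 * (G \<bullet> h) + (norm G)\<^sup>2"
    by (simp add: power2_norm_eq_inner inner_diff_left inner_diff_right inner_commute)
  have "\<tau> / 2 * (norm (h - G))\<^sup>2 = \<tau> / 2 * (norm h)\<^sup>2 + G \<bullet> (z m - z 0) + \<tau> / 2 * (norm G)\<^sup>2"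
    unfolding zm sq by (simp add: algebra_simps)
  moreover have "\<tau> / 2 * (norm (h - G))\<^sup>2 \<le> \<tau> / 2 * (L\<^sup>2 * X\<^sup>2)"
    using hG tau_pos by (intro mult_left_mono) auto
  ultimately show ?thesis using f 1 by linarith
qed

text \<open>Of the available \<tau>/2 times the squared norm of \<open>G\<close>, a share of 6/16
  pays for the coefficient 6 in \<open>lyapunov_arithmetic\<close>. The remaining \<tau>/8, with the
  decrease by 1/8 in the \<open>u 0\<close> term, pays for passing from \<open>G\<close> to
  \<open>Gx\<close>.\<close>

lemma lyapunov_descent:
  assumes f: "f1 \<le> f0 + G \<bullet> (z m - z 0) + L / 2 * (norm (z m - z 0))\<^sup>2"
    and Gx: "norm Gx \<le> norm G + L * norm (u 0)"
  shows "f1 + 7 / 4 * L\<^sup>2 * \<tau> / s * (norm (u m))\<^sup>2 + \<tau> / 16 * (norm Gx)\<^sup>2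
    \<le> f0 + 7 / 4 * L\<^sup>2 * \<tau> / s * (norm (u 0))\<^sup>2
      + 5 * L\<^sup>2 * \<tau> / s\<^sup>2 * ((\<tau> / real m)\<^sup>2 * (\<Sum>j<m. noise_weight m \<beta> (\<mu> * (1 - \<beta>)) j * (norm (R j))\<^sup>2))"
proof -
  let ?A = "norm (u 0)" and ?B = "\<tau> * norm G" and ?U = "norm (u m)"
  let ?k = "L\<^sup>2 * \<tau>"
  let ?N = "(\<tau> / real m)\<^sup>2 * (\<Sum>j<m. noise_weight m \<beta> (\<mu> * (1 - \<beta>)) j * (norm (R j))\<^sup>2)"
  have k: "0 \<le> ?k" using tau_pos by simp
  have C0: "0 \<le> C" "0 \<le> C'" using tau_pos s_bounds by (auto simp: C_def C'_def rms_nonneg)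
  have "X\<^sup>2 / 2 + 7 / 4 / s * ?U\<^sup>2
    \<le> (7 / 4 / s - 1 / 8) * ?A\<^sup>2 + 6 * (?B\<^sup>2 / s\<^sup>2) + 5 * ((C'\<^sup>2 + C\<^sup>2) / s\<^sup>2)"
    using s_bounds C0 X_nonneg X_absorbed norm_u_le tau_pos by (intro lyapunov_arithmetic) auto
  also have "(C'\<^sup>2 + C\<^sup>2) / s\<^sup>2 \<le> ?N / s\<^sup>2"
    using noise_le by (rule divide_right_mono) simp
  finally have "X\<^sup>2 / 2 + 7 / 4 / s * ?U\<^sup>2
    \<le> (7 / 4 / s - 1 / 8) * ?A\<^sup>2 + 6 * (?B\<^sup>2 / s\<^sup>2) + 5 * (?N / s\<^sup>2)" by simp
  from mult_left_mono[OF this k]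
  have 1: "?k * X\<^sup>2 / 2 + 7 / 4 * ?k / s * ?U\<^sup>2
    \<le> 7 / 4 * ?k / s * ?A\<^sup>2 - ?k * ?A\<^sup>2 / 8 + 6 * (?k * (?B\<^sup>2 / s\<^sup>2)) + 5 * ?k / s\<^sup>2 * ?N"
    by (simp add: algebra_simps)
  have 2: "?k * (?B\<^sup>2 / s\<^sup>2) \<le> \<tau> / 16 * (norm G)\<^sup>2"
  proof -
    have "(L * \<tau>)\<^sup>2 \<le> (s / 4)\<^sup>2" using L_tau_le L_pos tau_pos by (intro power_mono) auto
    hence "(L * \<tau>)\<^sup>2 / s\<^sup>2 \<le> (s / 4)\<^sup>2 / s\<^sup>2" by (rule divide_right_mono) simp
    hence "(L * \<tau>)\<^sup>2 / s\<^sup>2 \<le> 1 / 16" using s_bounds by (simp add: power_divide)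
    hence "(L * \<tau>)\<^sup>2 / s\<^sup>2 * (\<tau> * (norm G)\<^sup>2) \<le> 1 / 16 * (\<tau> * (norm G)\<^sup>2)"
      using tau_pos by (intro mult_right_mono) auto
    thus ?thesis by (simp add: power_mult_distrib mult_ac)
  qed
  have 3: "\<tau> / 16 * (norm Gx)\<^sup>2 \<le> \<tau> / 8 * (norm G)\<^sup>2 + ?k * ?A\<^sup>2 / 8"
  proof -
    have "(norm Gx)\<^sup>2 \<le> (norm G + L * ?A)\<^sup>2" using Gx by (intro power_mono) auto
    also have "\<dots> \<le> 2 * (norm G)\<^sup>2 + 2 * (L * ?A)\<^sup>2"
      using zero_le_power2[of "norm G - L * ?A"] by (simp add: power2_eq_square algebra_simps)
    finally have "\<tau> / 16 * (norm Gx)\<^sup>2 \<le> \<tau> / 16 * (2 * (norm G)\<^sup>2 + 2 * (L * ?A)\<^sup>2)"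
      using tau_pos by (intro mult_left_mono) auto
    thus ?thesis by (simp add: power_mult_distrib algebra_simps)
  qed
  have 4: "\<tau> / 2 * (L\<^sup>2 * X\<^sup>2) = ?k * X\<^sup>2 / 2" by simp
  have "f1 + 7 / 4 * ?k / s * ?U\<^sup>2 + \<tau> / 16 * (norm Gx)\<^sup>2
    \<le> f0 + 7 / 4 * ?k / s * ?A\<^sup>2 + 5 * ?k / s\<^sup>2 * ?N"
    using objective_descent[OF f] 1 2 3 unfolding 4 by linarith
  thus ?thesis by (simp only: mult.assoc)
qed

end

section \<open>Partial sums in random order\<close>

text \<open>As the total is zero, the sum over \<open>K\<close> may be replaced with minus the sum
  over its complement. One of the two has at most half the indices, so Cauchy-Schwarz costs at most
  \<open>card A / 2\<close>.\<close>

lemma norm_partial_sum_permuted_sq_le: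
  fixes h :: "'i \<Rightarrow> 'a::real_inner"
  assumes A: "finite A" and p: "p permutes A" and h0: "(\<Sum>i\<in>A. h i) = 0" and K: "K \<subseteq> A"
  shows "(norm (\<Sum>l\<in>K. h (p l)))\<^sup>2 \<le> real (card A) / 2 * (\<Sum>i\<in>A. (norm (h i))\<^sup>2)"
proof -
  have sp: "(\<Sum>l\<in>A. \<phi> (p l)) = (\<Sum>i\<in>A. \<phi> i)" for \<phi> :: "'i \<Rightarrow> 'b::comm_monoid_add"
    using sum.permute[OF p, of \<phi>] by (simp add: o_def)
  have fK: "finite K" using A K finite_subset by blast
  have le: "(\<Sum>l\<in>J. (norm (h (p l)))\<^sup>2) \<le> (\<Sum>i\<in>A. (norm (h i))\<^sup>2)" if "J \<subseteq> A" for J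
    unfolding sp[symmetric, of "\<lambda>i. (norm (h i))\<^sup>2"] using A that by (intro sum_mono2) auto
  have part: "(norm (\<Sum>l\<in>J. h (p l)))\<^sup>2 \<le> real (card A) / 2 * (\<Sum>i\<in>A. (norm (h i))\<^sup>2)"
    if "J \<subseteq> A" "2 * card J \<le> card A" for J
  proof -
    have "(norm (\<Sum>l\<in>J. h (p l)))\<^sup>2 \<le> real (card J) * (\<Sum>l\<in>J. (norm (h (p l)))\<^sup>2)"
      by (rule norm_sum_sq_le)
    also have "\<dots> \<le> real (card A) / 2 * (\<Sum>i\<in>A. (norm (h i))\<^sup>2)"
      using that by (intro mult_mono le sum_nonneg) auto
    finally show ?thesis .
  qed
  show ?thesis
  proof (cases "2 * card K \<le> card A")
    case False
    have "card (A - K) = card A - card K" using A K by (simp add: card_Diff_subset fK)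
    hence "2 * card (A - K) \<le> card A" using False by simp
    moreover have "(\<Sum>l\<in>A - K. h (p l)) = - (\<Sum>l\<in>K. h (p l))"
      using A K by (simp add: sum_diff sp h0)
    ultimately show ?thesis using part[of "A - K"] by simp
  qed (use part[OF K] in simp)
qed

text \<open>Sampling without replacement: distinct positions of a uniform permutation are negatively
  correlated, with correlation -1/(n-1).\<close>
lemma sum_permutations_norm_partial_sum_sq_le:
  fixes h :: "'i \<Rightarrow> 'a::real_inner"
  assumes A: "finite A" and h0: "(\<Sum>i\<in>A. h i) = 0" and K: "K \<subseteq> A"
  shows "(\<Sum>p | p permutes A. (norm (\<Sum>l\<in>K. h (p l)))\<^sup>2)
    \<le> real (card {p. p permutes A}) * ((\<Sum>i\<in>A. (norm (h i))\<^sup>2) / 2)"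
proof (cases "card A \<le> 1")
  case True
  hence "K = {} \<or> K = A"
    using A K by (metis One_nat_def card_0_eq card_seteq finite_subset le_SucE le_zero_eq card_mono)
  hence "(\<Sum>l\<in>K. h (p l)) = 0" if "p permutes A" for p
    using sum.permute[OF that, of h] h0 by (auto simp: o_def)
  hence "(\<Sum>p | p permutes A. (norm (\<Sum>l\<in>K. h (p l)))\<^sup>2) = 0"
    by (intro sum.neutral) auto
  thus ?thesis by (simp add: sum_nonneg)
next
  case False
  hence n2: "2 \<le> real (card A)" by simp
  let ?P = "{p. p permutes A}" and ?n = "real (card A)" and ?k = "real (card K)"
  define H where "H = (\<Sum>i\<in>A. (norm (h i))\<^sup>2)"
  define x where "x l = (\<Sum>p\<in>?P. (norm (h (p l)))\<^sup>2)" for l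
  define y where "y l l' = (\<Sum>p\<in>?P. h (p l) \<bullet> h (p l'))" for l l'
  have sp: "(\<Sum>l\<in>A. \<phi> (p l)) = (\<Sum>i\<in>A. \<phi> i)" if "p permutes A"
    for \<phi> :: "'i \<Rightarrow> 'b::comm_monoid_add" and p
    using sum.permute[OF that, of \<phi>] by (simp add: o_def)
  have fK: "finite K" using A K finite_subset by blast
  \<comment> \<open>Exchangeability: composing with a transposition of positions maps the set of
    permutations onto itself.\<close>
  have xeq: "x l = x l'" if "l \<in> A" "l' \<in> A" for l l'
    unfolding x_def
    by (subst sum_permutations_compose_right[OF permutes_swap_id[OF that]]) simp
  have yeq: "y l l' = y l l''" if "l \<in> A" "l' \<in> A" "l'' \<in> A" "l' \<noteq> l" "l'' \<noteq> l" for l l' l''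
    unfolding y_def
    by (subst sum_permutations_compose_right[OF permutes_swap_id[OF that(2,3)]])
       (use that in \<open>simp add: transpose_def\<close>)
  have yx: "y l l = x l" for l by (simp add: y_def x_def power2_norm_eq_inner)
  have nx: "?n * x l = real (card ?P) * H" if "l \<in> A" for l
  proof -
    have "?n * x l = (\<Sum>l'\<in>A. x l)" by simp
    also have "\<dots> = (\<Sum>l'\<in>A. x l')" by (intro sum.cong refl xeq that)
    also have "\<dots> = (\<Sum>p\<in>?P. \<Sum>l'\<in>A. (norm (h (p l')))\<^sup>2)" unfolding x_def by (rule sum.swap)
    also have "\<dots> = (\<Sum>p\<in>?P. H)"
      unfolding H_def by (intro sum.cong[OF refl] sp) simp
    finally show ?thesis by simp
  qed
  \<comment> \<open>For fixed \<open>l\<close> all mixed moments agree, and together with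
    \<open>y l l\<close> they sum to zero because the \<open>h i\<close> do.\<close>
  have y_val: "(?n - 1) * y l l' = - x l" if l: "l \<in> A" "l' \<in> A" "l' \<noteq> l" for l l'
  proof -
    have "(\<Sum>l''\<in>A. y l l'') = (\<Sum>p\<in>?P. h (p l) \<bullet> (\<Sum>l''\<in>A. h (p l'')))"
      unfolding y_def inner_sum_right by (rule sum.swap)
    also have "\<dots> = 0" by (intro sum.neutral) (auto simp: sp h0)
    finally have "y l l + (\<Sum>l''\<in>A - {l}. y l l'') = 0" using A l by (simp add: sum.remove)
    moreover have "(\<Sum>l''\<in>A - {l}. y l l'') = (\<Sum>l''\<in>A - {l}. y l l')"
      using l by (intro sum.cong refl yeq) auto
    moreover have "real (card (A - {l})) = ?n - 1" using A l False by simp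
    ultimately show ?thesis by (simp add: yx)
  qed
  have row: "(?n - 1) * (\<Sum>l'\<in>K. y l l') = (?n - ?k) * x l" if "l \<in> K" for l
  proof -
    have "(\<Sum>l'\<in>K. y l l') = x l + (\<Sum>l'\<in>K - {l}. y l l')"
      using fK that by (simp add: sum.remove yx)
    moreover have "(?n - 1) * (\<Sum>l'\<in>K - {l}. y l l') = (\<Sum>l'\<in>K - {l}. - x l)"
      unfolding sum_distrib_left using y_val K that by (intro sum.cong) auto
    moreover have "card K > 0" using fK that by (auto simp: card_gt_0_iff)
    hence "real (card (K - {l})) = ?k - 1" using fK that by simp
    ultimately show ?thesis by (simp add: algebra_simps)
  qed
  have "(\<Sum>p\<in>?P. (norm (\<Sum>l\<in>K. h (p l)))\<^sup>2) = (\<Sum>p\<in>?P. \<Sum>l\<in>K. \<Sum>l'\<in>K. h (p l) \<bullet> h (p l'))"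
    by (simp add: power2_norm_eq_inner inner_sum_left inner_sum_right) (intro sum.cong refl inner_commute)
  also have "\<dots> = (\<Sum>l\<in>K. \<Sum>l'\<in>K. y l l')"
    unfolding y_def by (subst sum.swap, intro sum.cong refl, rule sum.swap)
  finally have tot: "(\<Sum>p\<in>?P. (norm (\<Sum>l\<in>K. h (p l)))\<^sup>2) = (\<Sum>l\<in>K. \<Sum>l'\<in>K. y l l')" .
  have "?n * ((?n - 1) * (\<Sum>l\<in>K. \<Sum>l'\<in>K. y l l')) = (\<Sum>l\<in>K. ?n * ((?n - 1) * (\<Sum>l'\<in>K. y l l')))"
    by (simp add: sum_distrib_left)
  also have "\<dots> = (\<Sum>l\<in>K. (?n - ?k) * (real (card ?P) * H))"
  proof (intro sum.cong refl)
    fix l assume "l \<in> K"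
    thus "?n * ((?n - 1) * (\<Sum>l'\<in>K. y l l')) = (?n - ?k) * (real (card ?P) * H)"
      using row[of l] nx[of l] K by (auto simp: mult.left_commute)
  qed
  also have "\<dots> = (?k * (?n - ?k)) * (real (card ?P) * H)" by simp
  also have "\<dots> \<le> (?n * (?n - 1) / 2) * (real (card ?P) * H)"
  proof (intro mult_right_mono)
    \<comment> \<open>\<open>k * (n - k)\<close> is at most \<open>n\<^sup>2 / 4\<close>, hence at
      most \<open>n * (n - 1) / 2\<close> once \<open>n \<ge> 2\<close>; the case of at most one
      index was split off for this and for the division by \<open>n - 1\<close>.\<close>
    have "4 * (?k * (?n - ?k)) \<le> ?n * ?n"
      using zero_le_power2[of "?n - 2 * ?k"] by (simp add: power2_eq_square algebra_simps)
    moreover have "?n * 2 \<le> ?n * ?n" using n2 by (intro mult_left_mono) auto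
    ultimately show "?k * (?n - ?k) \<le> ?n * (?n - 1) / 2" by (simp add: algebra_simps)
  qed (auto simp: H_def sum_nonneg)
  finally have "(?n * (?n - 1)) * (\<Sum>l\<in>K. \<Sum>l'\<in>K. y l l') \<le> (?n * (?n - 1)) * (real (card ?P) * (H / 2))"
    by (simp add: mult_ac)
  moreover have "0 < ?n * (?n - 1)" using n2 by simp
  ultimately have "(\<Sum>l\<in>K. \<Sum>l'\<in>K. y l l') \<le> real (card ?P) * (H / 2)"
    by (rule mult_left_le_imp_le)
  thus ?thesis unfolding tot H_def .
qed

text \<open>Independence of coordinates in finite form: redrawing coordinate \<open>k\<close>
  uniformly does not change an average over the product set.\<close>

lemma sum_PiE_resample:
  fixes \<Phi> :: "('i \<Rightarrow> 'b) \<Rightarrow> real"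
  assumes I: "finite I" "k \<in> I"
  shows "(\<Sum>\<omega>\<in>PiE I (\<lambda>_. P). \<Sum>p\<in>P. \<Phi> (fun_upd \<omega> k p)) = real (card P) * (\<Sum>\<omega>\<in>PiE I (\<lambda>_. P). \<Phi> \<omega>)"
proof -
  have split: "(\<Sum>\<omega>\<in>PiE I (\<lambda>_. P). \<Psi> \<omega>) = (\<Sum>y\<in>P. \<Sum>q\<in>PiE (I - {k}) (\<lambda>_. P). \<Psi> (fun_upd q k y))"
    for \<Psi> :: "('i \<Rightarrow> 'b) \<Rightarrow> real"
  proof -
    have "PiE I (\<lambda>_. P) = PiE (insert k (I - {k})) (\<lambda>_. P)" using I by (simp add: insert_absorb)
    also have "\<dots> = (\<lambda>(y, q). fun_upd q k y) ` (P \<times> PiE (I - {k}) (\<lambda>_. P))"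
      by (rule PiE_insert_eq)
    finally have "(\<Sum>\<omega>\<in>PiE I (\<lambda>_. P). \<Psi> \<omega>)
        = (\<Sum>(y, q)\<in>P \<times> PiE (I - {k}) (\<lambda>_. P). \<Psi> (fun_upd q k y))"
      using inj_combinator[of k "I - {k}" "\<lambda>_. P"]
      by (simp add: sum.reindex case_prod_unfold)
    thus ?thesis by (simp add: sum.cartesian_product)
  qed
  have "(\<Sum>\<omega>\<in>PiE I (\<lambda>_. P). \<Sum>p\<in>P. \<Phi> (fun_upd \<omega> k p))
      = real (card P) * (\<Sum>q\<in>PiE (I - {k}) (\<lambda>_. P). \<Sum>p\<in>P. \<Phi> (fun_upd q k p))"
    unfolding split by simp
  also have "(\<Sum>q\<in>PiE (I - {k}) (\<lambda>_. P). \<Sum>p\<in>P. \<Phi> (fun_upd q k p)) = (\<Sum>\<omega>\<in>PiE I (\<lambda>_. P). \<Phi> \<omega>)"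
    unfolding split by (rule sum.swap)
  finally show ?thesis .
qed

text \<open>Discrete Gronwall. All growth factors are at least 1, so the terms \<open>a k\<close>
  collected so far may be multiplied by them as well.\<close>

lemma perturbed_descent_sum_le:
  fixes e a c :: "nat \<Rightarrow> real"
  assumes step: "\<And>k. 1 \<le> k \<Longrightarrow> k \<le> T \<Longrightarrow> e (Suc k) + a k \<le> (1 + c k) * e k"
    and a: "\<And>k. 1 \<le> k \<Longrightarrow> k \<le> T \<Longrightarrow> 0 \<le> a k" and c: "\<And>k. 1 \<le> k \<Longrightarrow> k \<le> T \<Longrightarrow> 0 \<le> c k"
  shows "e (Suc T) + (\<Sum>k=1..T. a k) \<le> (\<Prod>k=1..T. 1 + c k) * e 1"
  using assms
proof (induction T)
  case (Suc T)
  have "0 \<le> c (Suc T) * (\<Sum>k=1..T. a k)"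
    using Suc.prems by (intro mult_nonneg_nonneg sum_nonneg) auto
  hence "e (Suc (Suc T)) + (\<Sum>k=1..Suc T. a k) \<le> (1 + c (Suc T)) * (e (Suc T) + (\<Sum>k=1..T. a k))"
    using Suc.prems(1)[of "Suc T"]
    by (simp add: algebra_simps)
  also have "\<dots> \<le> (1 + c (Suc T)) * ((\<Prod>k=1..T. 1 + c k) * e 1)"
    using Suc by (intro mult_left_mono) auto
  finally show ?case by (simp add: mult_ac)
qed simp

text \<open>The product is at most the exponential of the sum, and exp S is at most 1 + S + S^2 for
  S in [0, 1].\<close>

lemma prod_one_plus_le:
  fixes c :: "nat \<Rightarrow> real"
  assumes "\<And>k. k \<in> I \<Longrightarrow> 0 \<le> c k" "finite I" "(\<Sum>k\<in>I. c k) \<le> 1"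
  shows "(\<Prod>k\<in>I. 1 + c k) \<le> 1 + 3 * (\<Sum>k\<in>I. c k)"
proof -
  let ?S = "\<Sum>k\<in>I. c k"
  have S: "0 \<le> ?S" using assms by (intro sum_nonneg)
  have "(\<Prod>k\<in>I. 1 + c k) \<le> (\<Prod>k\<in>I. exp (c k))"
    using assms by (intro prod_mono) (auto intro: exp_ge_add_one_self)
  also have "\<dots> = exp ?S" using assms by (simp add: exp_sum)
  also have "\<dots> \<le> 1 + ?S + ?S\<^sup>2" using S assms by (intro exp_bound) auto
  also have "?S\<^sup>2 \<le> ?S" using S assms by (simp add: power2_eq_square mult_left_le)
  finally show ?thesis using S by simp
qed

lemma sum_consecutive_blocks:
  fixes \<phi> :: "nat \<Rightarrow> 'a::comm_monoid_add"
  shows "(\<Sum>i<j. \<Sum>l\<in>{i * b + 1..Suc i * b}. \<phi> l) = (\<Sum>l\<in>{1..j * b}. \<phi> l)"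
proof (induction j)
  case (Suc j)
  have "(\<Sum>l\<in>{1..j * b + b}. \<phi> l) = (\<Sum>l\<in>{1..j * b}. \<phi> l) + (\<Sum>l\<in>{j * b + 1..j * b + b}. \<phi> l)"
    by (rule sum.ub_add_nat) simp
  thus ?case using Suc by (simp add: add.commute)
qed simp

section \<open>Convergence of random reshuffling with momentum\<close>

locale rrm =
  fixes F :: "nat \<Rightarrow> 'a::euclidean_space \<Rightarrow> real" and g :: "nat \<Rightarrow> 'a \<Rightarrow> 'a"
    and n b m :: nat and L fbar bet lam :: real and alpha :: "nat \<Rightarrow> real" and x1 :: 'a
  assumes n_pos: "n \<ge> 1" and b_pos: "b \<ge> 1" and nbm: "n = m * b"
    and grad: "\<And>i x. i \<in> {1..n} \<Longrightarrow> (F i has_derivative (\<lambda>h. g i x \<bullet> h)) (at x)"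
    and L_pos: "L > 0"
    and lip: "\<And>i x y. i \<in> {1..n} \<Longrightarrow> norm (g i x - g i y) \<le> L * norm (x - y)"
    and lower: "\<And>i x. i \<in> {1..n} \<Longrightarrow> F i x \<ge> fbar"
    and alpha_mono: "\<And>k. k \<ge> 1 \<Longrightarrow> alpha (Suc k) \<le> alpha k"
    and bet: "0 \<le> bet" "bet < 1"
    and lam: "0 \<le> lam" "lam \<le> bet / (1 - bet)"
    and alpha_pos: "\<And>k. k \<ge> 1 \<Longrightarrow> alpha k > 0"
    and alpha_le: "\<And>k. k \<ge> 1 \<Longrightarrow> alpha k \<le> (1 - bet) * (1 - bet ^ m) / (4 * L * real m)"
begin

section \<open>Averaged objective, shifted iterates and Lyapunov function\<close>

definition "gradf x = (1 / real n) *\<^sub>R (\<Sum>i\<in>{1..n}. g i x)"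
definition "favg x = (1 / real n) * (\<Sum>i\<in>{1..n}. F i x)"
text \<open>The shifted iterate \<open>zz\<close> is \<open>(x - bet * xtilde) / (1 - bet)\<close>: it moves by plain
  gradient steps of size \<open>alpha / (1 - bet)\<close>, without momentum.\<close>
definition "state pp k = rrm_state g b m alpha bet lam pp x1 k"
definition "uu pp k = (bet / (1 - bet)) *\<^sub>R (snd (state pp k) - fst (state pp k))"
definition "zz pp k = snd (state pp k) + uu pp k"
definition "xx pp k = rrm_x g b m alpha bet lam pp x1 k"
definition "tau k = real m * alpha k / (1 - bet)"
definition "gap pp k = favg (zz pp k) - fbar"
definition "lyap pp k = gap pp k + 7 / 4 * L\<^sup>2 * tau k / (1 - bet ^ m) * (norm (uu pp k))\<^sup>2"
definition "noise z p = (\<Sum>j<m. noise_weight m bet ((bet / (1 - bet) - lam) * (1 - bet)) j *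
  (norm ((1 / real b) *\<^sub>R (\<Sum>l\<in>{1..j * b}. g (p l) z - gradf z)))\<^sup>2)"

lemma m_pos: "0 < m" using n_pos nbm by (cases m) auto

lemma one_minus_pow_pos: "0 < 1 - bet ^ m"
  using bet m_pos by (simp add: power_less_one_iff)

lemma tau_pos: "k \<ge> 1 \<Longrightarrow> 0 < tau k"
  using m_pos bet alpha_pos by (simp add: tau_def)

lemma favg_deriv: "(favg has_derivative (\<lambda>h. gradf x \<bullet> h)) (at x)"
proof -
  have "((\<lambda>x. (1 / real n) * (\<Sum>i\<in>{1..n}. F i x)) has_derivative
      (\<lambda>h. (1 / real n) * (\<Sum>i\<in>{1..n}. g i x \<bullet> h))) (at x)"
    by (intro has_derivative_mult_right has_derivative_sum grad)
  thus ?thesis by (simp add: favg_def[abs_def] gradf_def inner_sum_left)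
qed

lemma gradf_lip: "norm (gradf x - gradf y) \<le> L * norm (x - y)"
proof -
  have "norm (\<Sum>i\<in>{1..n}. g i x - g i y) \<le> (\<Sum>i\<in>{1..n}. L * norm (x - y))"
    by (intro sum_norm_le lip)
  hence "norm (\<Sum>i\<in>{1..n}. g i x - g i y) / real n \<le> (real n * (L * norm (x - y))) / real n"
    by (intro divide_right_mono) auto
  moreover have "gradf x - gradf y = (1 / real n) *\<^sub>R (\<Sum>i\<in>{1..n}. g i x - g i y)"
    by (simp add: gradf_def sum_subtractf scaleR_right_diff_distrib)
  ultimately show ?thesis using n_pos by simp
qed

lemma favg_lower: "fbar \<le> favg x"
proof -
  have "(\<Sum>i\<in>{1..n}. fbar) \<le> (\<Sum>i\<in>{1..n}. F i x)" by (intro sum_mono lower)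
  thus ?thesis using n_pos by (simp add: favg_def field_simps)
qed

lemma gap_nonneg: "0 \<le> gap pp k" using favg_lower by (simp add: gap_def)

lemma gap_le_lyap: "k \<ge> 1 \<Longrightarrow> gap pp k \<le> lyap pp k"
  using tau_pos[of k] one_minus_pow_pos by (simp add: lyap_def)

lemma lyap_nonneg: "k \<ge> 1 \<Longrightarrow> 0 \<le> lyap pp k"
  using gap_le_lyap gap_nonneg order_trans by blast

lemma sum_deviation: "(\<Sum>i\<in>{1..n}. g i x - gradf x) = 0"
  using n_pos by (simp add: sum_subtractf gradf_def sum_constant_scaleR)

text \<open>The variance is at most the second moment. Each squared gradient is controlled by the
  gap of its own \<open>F i\<close> above the common bound \<open>fbar\<close>, and these gaps sum
  to \<open>n\<close> times the gap of the average.\<close>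

lemma sum_deviation_sq_le: "(\<Sum>i\<in>{1..n}. (norm (g i x - gradf x))\<^sup>2) \<le> 2 * L * real n * (favg x - fbar)"
proof -
  have "(\<Sum>i\<in>{1..n}. (norm (g i x - gradf x))\<^sup>2)
      = (\<Sum>i\<in>{1..n}. (norm (g i x))\<^sup>2 - 2 * (gradf x \<bullet> (g i x - gradf x)) - (norm (gradf x))\<^sup>2)"
    by (intro sum.cong refl) (simp add: power2_norm_eq_inner inner_diff_left inner_diff_right inner_commute)
  also have "\<dots> = (\<Sum>i\<in>{1..n}. (norm (g i x))\<^sup>2) - 2 * (gradf x \<bullet> (\<Sum>i\<in>{1..n}. g i x - gradf x))
      - real n * (norm (gradf x))\<^sup>2"
    by (simp add: sum_subtractf inner_sum_right sum_distrib_left inner_diff_right)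
  also have "\<dots> \<le> (\<Sum>i\<in>{1..n}. (norm (g i x))\<^sup>2)"
    unfolding sum_deviation by simp
  also have "\<dots> \<le> (\<Sum>i\<in>{1..n}. 2 * L * (F i x - fbar))"
    by (intro sum_mono gradient_norm_sq_le_gap grad lip lower L_pos)
  also have "\<dots> = 2 * L * ((\<Sum>i\<in>{1..n}. F i x) - real n * fbar)"
    by (simp add: sum_distrib_left[symmetric] sum_subtractf)
  also have "\<dots> = 2 * L * real n * (favg x - fbar)"
    using n_pos by (simp add: favg_def field_simps)
  finally show ?thesis .
qed

lemma epoch_step:
  assumes k: "k \<ge> 1" and p: "pp k permutes {1..n}"
  shows "lyap pp (Suc k) + tau k / 16 * (norm (gradf (xx pp k)))\<^sup>2
    \<le> lyap pp k + 5 * L\<^sup>2 * tau k / (1 - bet ^ m)\<^sup>2 * ((tau k / real m)\<^sup>2 * noise (zz pp k) (pp k))"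
proof -
  define inn where "inn i = rrm_inner g b (alpha k) bet lam (pp k) (state pp k) i" for i
  define v where "v i = snd (inn i) - fst (inn i)" for i
  define z where "z i = snd (inn i) + (bet / (1 - bet)) *\<^sub>R v i" for i
  \<comment> \<open>This choice makes \<open>z i - \<mu> *\<^sub>R v i\<close> the extrapolated
    point \<open>yh i\<close>.\<close>
  define \<mu> where "\<mu> = bet / (1 - bet) - lam"
  define yh where "yh i = snd (inn i) + lam *\<^sub>R v i" for i
  define d where "d i = (1 / real b) *\<^sub>R (\<Sum>j\<in>{i * b + 1..Suc i * b}. g (pp k j) (yh i))" for i
  define G where "G = gradf (z 0)"
  \<comment> \<open>The deviations are taken at the fixed point \<open>z 0\<close>, so that they
    cancel over the whole epoch whatever the permutation.\<close>
  define r where "r i = (1 / real b) *\<^sub>R (\<Sum>j\<in>{i * b + 1..Suc i * b}. g (pp k j) (z 0) - G)" for i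
  have inn0: "inn 0 = state pp k" by (simp add: inn_def)
  \<comment> \<open>The recursion of \<open>rrm_state\<close> runs an epoch only at a successor
    index; index 0 is a dummy.\<close>
  obtain k' where k': "k = Suc k'" using k by (cases k) auto
  have innm: "inn m = state pp (Suc k)" by (simp add: inn_def state_def k')
  have innS: "inn (Suc i) = (snd (inn i), snd (inn i) - alpha k *\<^sub>R d i + bet *\<^sub>R v i)" for i
    by (simp add: inn_def d_def yh_def v_def Let_def)
  have vS: "v (Suc i) = bet *\<^sub>R v i - alpha k *\<^sub>R d i" for i
    by (subst v_def) (simp add: innS)
  have zS: "z (Suc i) = z i - (alpha k / (1 - bet)) *\<^sub>R d i" for i
  proof -
    have 1: "snd (inn (Suc i)) = snd (inn i) + v (Suc i)" by (simp add: innS vS)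
    have 2: "1 + bet / (1 - bet) = 1 / (1 - bet)" using bet by (simp add: field_simps)
    have "z (Suc i) = snd (inn i) + (1 + bet / (1 - bet)) *\<^sub>R v (Suc i)"
      unfolding z_def 1 by (simp add: scaleR_left_distrib)
    also have "\<dots> = snd (inn i) + (1 / (1 - bet)) *\<^sub>R (bet *\<^sub>R v i - alpha k *\<^sub>R d i)"
      unfolding 2 vS ..
    also have "\<dots> = z i - (alpha k / (1 - bet)) *\<^sub>R d i"
      by (simp add: z_def scaleR_right_diff_distrib)
    finally show ?thesis .
  qed
  have yh_eq: "z i - \<mu> *\<^sub>R v i = yh i" for i
    by (simp add: z_def \<mu>_def yh_def scaleR_left_diff_distrib)
  have block: "real (card {i * b + 1..Suc i * b}) = real b" for i by simp
  have b0: "real b \<noteq> 0" using b_pos by simp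
  have derr: "norm (d i - G - r i) \<le> L * norm (z i - \<mu> *\<^sub>R v i - z 0)" if "i < m" for i
  proof -
    let ?I = "{i * b + 1..Suc i * b}"
    have I: "pp k j \<in> {1..n}" if "j \<in> ?I" for j
    proof -
      have "Suc i * b \<le> m * b" using \<open>i < m\<close> by (intro mult_right_mono) auto
      hence "j \<in> {1..n}" using that nbm by auto
      thus ?thesis using permutes_in_image[OF p] by blast
    qed
    have "(\<Sum>j\<in>?I. G) = real b *\<^sub>R G" using block[of i] by (simp add: sum_constant_scaleR)
    hence "d i - G - r i = (1 / real b) *\<^sub>R (\<Sum>j\<in>?I. g (pp k j) (yh i) - g (pp k j) (z 0))"
      unfolding d_def r_def sum_subtractf using b0 by (simp add: scaleR_right_diff_distrib)
    hence "norm (d i - G - r i) = norm (\<Sum>j\<in>?I. g (pp k j) (yh i) - g (pp k j) (z 0)) / real b" by simp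
    also have "\<dots> \<le> (\<Sum>j\<in>?I. L * norm (yh i - z 0)) / real b"
      by (intro divide_right_mono sum_norm_le lip I) auto
    also have "\<dots> = L * norm (yh i - z 0)" using block[of i] b0 by simp
    finally show ?thesis by (simp add: yh_eq)
  qed
  have Rsum: "(\<Sum>i<j. r i) = (1 / real b) *\<^sub>R (\<Sum>l\<in>{1..j * b}. g (pp k l) (z 0) - G)" for j
    unfolding r_def scaleR_sum_right[symmetric] sum_consecutive_blocks ..
  have "(\<Sum>l\<in>{1..n}. g (pp k l) (z 0) - G) = 0"
    using sum.permute[OF p, of "\<lambda>i. g i (z 0) - G"] sum_deviation[of "z 0"] by (simp add: o_def G_def)
  hence sum_r: "(\<Sum>i<m. r i) = 0" unfolding Rsum nbm by simp
  have mu: "0 \<le> \<mu>" "\<mu> \<le> bet / (1 - bet)" using lam by (simp_all add: \<mu>_def)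
  interpret ep: rrm_epoch m L "alpha k" bet \<mu> G d r v z
    using m_pos L_pos alpha_pos[OF k] bet mu alpha_le[OF k] vS zS derr sum_r
    by unfold_locales auto
  have z0: "z 0 = zz pp k" by (simp add: z_def v_def inn0 zz_def uu_def)
  have zm: "z m = zz pp (Suc k)" by (simp add: z_def v_def innm zz_def uu_def)
  have u0: "ep.u 0 = uu pp k" by (simp add: ep.u_def v_def inn0 uu_def)
  have um: "ep.u m = uu pp (Suc k)" by (simp add: ep.u_def v_def innm uu_def)
  have t: "ep.\<tau> = tau k" by (simp add: ep.\<tau>_def tau_def)
  have R: "ep.R j = (1 / real b) *\<^sub>R (\<Sum>l\<in>{1..j * b}. g (pp k l) (zz pp k) - gradf (zz pp k))" for j
    unfolding ep.R_def Rsum by (simp add: G_def z0)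
  have noise: "(\<Sum>j<m. noise_weight m bet (\<mu> * (1 - bet)) j * (norm (ep.R j))\<^sup>2) = noise (zz pp k) (pp k)"
    unfolding noise_def R \<mu>_def ..
  have x: "zz pp k - xx pp k = uu pp k" by (simp add: zz_def xx_def rrm_x_def state_def)
  have Gx: "norm (gradf (xx pp k)) \<le> norm G + L * norm (ep.u 0)"
  proof -
    have "norm (gradf (xx pp k)) \<le> norm G + norm (G - gradf (xx pp k))"
      using norm_triangle_sub[of "gradf (xx pp k)" G] by (simp add: norm_minus_commute)
    also have "norm (G - gradf (xx pp k)) \<le> L * norm (ep.u 0)"
      unfolding G_def z0 u0 x[symmetric] by (rule gradf_lip)
    finally show ?thesis by simp
  qed
  have f: "favg (z m) \<le> favg (z 0) + G \<bullet> (z m - z 0) + L / 2 * (norm (z m - z 0))\<^sup>2"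
    unfolding G_def by (rule lipschitz_gradient_upper_bound[OF favg_deriv gradf_lip])
  have "favg (zz pp (Suc k)) + 7 / 4 * L\<^sup>2 * tau k / (1 - bet ^ m) * (norm (uu pp (Suc k)))\<^sup>2
      + tau k / 16 * (norm (gradf (xx pp k)))\<^sup>2
    \<le> favg (zz pp k) + 7 / 4 * L\<^sup>2 * tau k / (1 - bet ^ m) * (norm (uu pp k))\<^sup>2
      + 5 * L\<^sup>2 * tau k / (1 - bet ^ m)\<^sup>2 * ((tau k / real m)\<^sup>2 * noise (zz pp k) (pp k))"
    using ep.lyapunov_descent[OF f Gx] unfolding noise t ep.s_def z0 zm u0 um .
  \<comment> \<open>Non-increasing step sizes allow \<open>tau k\<close> to become
    \<open>tau (Suc k)\<close> in front of the new \<open>uu\<close>, as \<open>lyap\<close>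
    demands.\<close>
  moreover have "7 / 4 * L\<^sup>2 * tau (Suc k) / (1 - bet ^ m) * (norm (uu pp (Suc k)))\<^sup>2
      \<le> 7 / 4 * L\<^sup>2 * tau k / (1 - bet ^ m) * (norm (uu pp (Suc k)))\<^sup>2"
    using alpha_mono[OF k] one_minus_pow_pos bet
    by (intro mult_right_mono divide_right_mono mult_left_mono) (auto simp: tau_def intro!: divide_right_mono mult_left_mono)
  ultimately show ?thesis unfolding lyap_def gap_def by linarith
qed

section \<open>Noise bounds for fixed and for random permutations\<close>

lemma noise_weights:
  "0 \<le> noise_weight m bet ((bet / (1 - bet) - lam) * (1 - bet)) j"
  "(\<Sum>j<m. noise_weight m bet ((bet / (1 - bet) - lam) * (1 - bet)) j) \<le> 2"
proof -
  let ?e = "(bet / (1 - bet) - lam) * (1 - bet)"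
  have "0 \<le> ?e" using lam bet by (intro mult_nonneg_nonneg) auto
  moreover have "?e = bet - lam * (1 - bet)" using bet by (simp add: field_simps)
  moreover have "0 \<le> lam * (1 - bet)" using lam bet by simp
  ultimately have e: "0 \<le> ?e" "?e \<le> 1" using bet by linarith+
  show "0 \<le> noise_weight m bet ?e j" by (rule noise_weight_nonneg[OF bet e])
  show "(\<Sum>j<m. noise_weight m bet ?e j) \<le> 2" by (rule sum_noise_weight_le[OF bet e m_pos])
qed

text \<open>A singleton \<open>P\<close> gives the worst case, the set of all permutations the
  average. The factor 2 is the total noise weight.\<close>

lemma sum_noise_le:
  assumes P: "\<And>K. K \<subseteq> {1..n} \<Longrightarrow> (\<Sum>p\<in>P. (norm (\<Sum>l\<in>K. g (p l) z - gradf z))\<^sup>2) \<le> M"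
  shows "(\<Sum>p\<in>P. noise z p) \<le> 2 * M / (real b)\<^sup>2"
proof -
  let ?w = "noise_weight m bet ((bet / (1 - bet) - lam) * (1 - bet))"
  have M: "0 \<le> M" using P[of "{}"] by simp
  have "(\<Sum>p\<in>P. noise z p)
      = (\<Sum>j<m. ?w j * (\<Sum>p\<in>P. (norm ((1 / real b) *\<^sub>R (\<Sum>l\<in>{1..j * b}. g (p l) z - gradf z)))\<^sup>2))"
    unfolding noise_def by (subst sum.swap) (simp add: sum_distrib_left)
  also have "\<dots> \<le> (\<Sum>j<m. ?w j * (M / (real b)\<^sup>2))"
  proof (intro sum_mono mult_left_mono noise_weights)
    fix j assume "j \<in> {..<m}"
    hence "j * b \<le> n" unfolding nbm by (intro mult_right_mono) auto
    hence "{1..j * b} \<subseteq> {1..n}" by auto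
    from P[OF this] show "(\<Sum>p\<in>P. (norm ((1 / real b) *\<^sub>R (\<Sum>l\<in>{1..j * b}. g (p l) z - gradf z)))\<^sup>2)
        \<le> M / (real b)\<^sup>2"
      by (simp add: power_divide sum_divide_distrib[symmetric] divide_right_mono)
  qed
  also have "\<dots> = (\<Sum>j<m. ?w j) * (M / (real b)\<^sup>2)" by (rule sum_distrib_right[symmetric])
  also have "\<dots> \<le> 2 * (M / (real b)\<^sup>2)"
    using M by (intro mult_right_mono noise_weights) auto
  finally show ?thesis by simp
qed

lemma noise_le_arbitrary:
  assumes "p permutes {1..n}"
  shows "noise z p \<le> 2 * (L * (real n)\<^sup>2 * (favg z - fbar)) / (real b)\<^sup>2"
proof -
  have "(\<Sum>p\<in>{p}. (norm (\<Sum>l\<in>K. g (p l) z - gradf z))\<^sup>2) \<le> L * (real n)\<^sup>2 * (favg z - fbar)"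
    if "K \<subseteq> {1..n}" for K
  proof -
    have "(\<Sum>p\<in>{p}. (norm (\<Sum>l\<in>K. g (p l) z - gradf z))\<^sup>2)
        \<le> real n / 2 * (\<Sum>i\<in>{1..n}. (norm (g i z - gradf z))\<^sup>2)"
      using norm_partial_sum_permuted_sq_le[of "{1..n}" p "\<lambda>i. g i z - gradf z" K] assms that sum_deviation
      by simp
    also have "\<dots> \<le> real n / 2 * (2 * L * real n * (favg z - fbar))"
      by (intro mult_left_mono sum_deviation_sq_le) auto
    also have "\<dots> = L * (real n)\<^sup>2 * (favg z - fbar)"
      unfolding power2_eq_square by (simp only: mult_ac times_divide_eq_left times_divide_eq_right)
    finally show ?thesis .
  qed
  from sum_noise_le[OF this] show ?thesis by simp
qed

lemma noise_le_average:
  "(\<Sum>p | p permutes {1..n}. noise z p)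
    \<le> real (card {p. p permutes {1..n}}) * (2 * (L * real n * (favg z - fbar)) / (real b)\<^sup>2)"
proof -
  let ?P = "{p. p permutes {1..n}}"
  have "(\<Sum>p\<in>?P. (norm (\<Sum>l\<in>K. g (p l) z - gradf z))\<^sup>2) \<le> real (card ?P) * (L * real n * (favg z - fbar))"
    if "K \<subseteq> {1..n}" for K
  proof -
    have "(\<Sum>p\<in>?P. (norm (\<Sum>l\<in>K. g (p l) z - gradf z))\<^sup>2)
        \<le> real (card ?P) * ((\<Sum>i\<in>{1..n}. (norm (g i z - gradf z))\<^sup>2) / 2)"
      using sum_permutations_norm_partial_sum_sq_le[of "{1..n}" "\<lambda>i. g i z - gradf z" K] that sum_deviation
      by simp
    also have "\<dots> \<le> real (card ?P) * (2 * L * real n * (favg z - fbar) / 2)"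
      by (intro mult_left_mono divide_right_mono sum_deviation_sq_le) auto
    finally show ?thesis by simp
  qed
  from sum_noise_le[OF this] show ?thesis by (simp only: mult.left_commute times_divide_eq_right)
qed

definition "DD = 10 / (1 - bet ^ m)\<^sup>2 * (L / (1 - bet)) ^ 3"

lemma DD_pos: "0 < DD"
  using one_minus_pow_pos L_pos bet by (simp add: DD_def)

text \<open>The 10 in \<open>DD\<close> is 5 from the Lyapunov step times 2 from the noise weights.
  \<open>c\<close> stands for the squared sample size in the worst case and for the sample size
  itself on average.\<close>

lemma noise_coefficient:
  "5 * L\<^sup>2 * tau k / (1 - bet ^ m)\<^sup>2 * ((tau k / real m)\<^sup>2 * (2 * (L * c * y) / (real b)\<^sup>2))
    = DD * real m ^ 3 * alpha k ^ 3 * c / (real n)\<^sup>2 * y"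
proof -
  have n2: "(real n)\<^sup>2 = (real m)\<^sup>2 * (real b)\<^sup>2" by (simp add: nbm power_mult_distrib)
  have "DD * real m ^ 3 * alpha k ^ 3 = 10 / (1 - bet ^ m)\<^sup>2 * (L * tau k) ^ 3"
    by (simp add: DD_def tau_def power_mult_distrib power_divide)
  thus ?thesis
    unfolding n2 by (simp add: power2_eq_square power3_eq_cube)
qed

lemma lyap_step_arbitrary:
  assumes k: "k \<ge> 1" and p: "pp k permutes {1..n}"
  shows "lyap pp (Suc k) + tau k / 16 * (norm (gradf (xx pp k)))\<^sup>2
    \<le> (1 + DD * real m ^ 3 * alpha k ^ 3) * lyap pp k"
proof -
  have "5 * L\<^sup>2 * tau k / (1 - bet ^ m)\<^sup>2 * ((tau k / real m)\<^sup>2 * noise (zz pp k) (pp k))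
    \<le> 5 * L\<^sup>2 * tau k / (1 - bet ^ m)\<^sup>2 * ((tau k / real m)\<^sup>2 * (2 * (L * (real n)\<^sup>2 * gap pp k) / (real b)\<^sup>2))"
    unfolding gap_def using tau_pos[OF k]
    by (intro mult_left_mono noise_le_arbitrary p) auto
  also have "\<dots> = DD * real m ^ 3 * alpha k ^ 3 * gap pp k"
    unfolding noise_coefficient using n_pos by simp
  also have "\<dots> \<le> DD * real m ^ 3 * alpha k ^ 3 * lyap pp k"
    using DD_pos alpha_pos[OF k] gap_le_lyap[OF k] by (intro mult_left_mono) auto
  finally show ?thesis using epoch_step[of k pp, OF k p] by (simp add: distrib_right)
qed

text \<open>The state at the start of epoch \<open>k\<close> depends only on strictly earlier
  permutations; this is what makes the permutation of epoch \<open>k\<close> independent of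
  it.\<close>

lemma rrm_state_cong:
  "(\<And>j. 1 \<le> j \<Longrightarrow> j < k \<Longrightarrow> pp j = pp' j) \<Longrightarrow>
    rrm_state g b m alpha bet lam pp x1 k = rrm_state g b m alpha bet lam pp' x1 k"
proof (induction k)
  case (Suc k)
  thus ?case by (cases k) auto
qed simp

lemma lyap_step_average:
  assumes k: "k \<ge> 1" "k \<le> T"
  shows "(\<Sum>pp\<in>perm_seqs n T. lyap pp (Suc k)) + tau k / 16 * (\<Sum>pp\<in>perm_seqs n T. (norm (gradf (xx pp k)))\<^sup>2)
    \<le> (1 + DD * (real m)\<^sup>2 / real b * alpha k ^ 3) * (\<Sum>pp\<in>perm_seqs n T. lyap pp k)"
proof -
  let ?\<Omega> = "perm_seqs n T" and ?P = "{p. p permutes {1..n}}"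
  let ?N = "\<lambda>pp. 2 * (L * real n * gap pp k) / (real b)\<^sup>2"
  let ?c = "5 * L\<^sup>2 * tau k / (1 - bet ^ m)\<^sup>2" and ?t = "(tau k / real m)\<^sup>2"
  have n: "real n = real m * real b" by (simp add: nbm)
  have coef: "DD * real m ^ 3 * alpha k ^ 3 * real n / (real n)\<^sup>2 = DD * (real m)\<^sup>2 / real b * alpha k ^ 3"
    using m_pos b_pos unfolding n by (simp add: power2_eq_square power3_eq_cube)
  have cardP: "0 < real (card ?P)" by (simp add: card_permutations[OF refl])
  have perm: "pp k permutes {1..n}" if "pp \<in> ?\<Omega>" for pp
    using that k by (auto simp: perm_seqs_def PiE_iff)
  have z: "zz (fun_upd pp k p) k = zz pp k" for pp p
    unfolding zz_def uu_def state_def using rrm_state_cong[of k "fun_upd pp k p" pp] by simp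
  \<comment> \<open>Redrawing the permutation of epoch \<open>k\<close> leaves
    \<open>zz pp k\<close> unchanged, so the noise can be averaged with its starting point held
    fixed.\<close>
  have "real (card ?P) * (\<Sum>pp\<in>?\<Omega>. noise (zz pp k) (pp k))
      = (\<Sum>pp\<in>?\<Omega>. \<Sum>p\<in>?P. noise (zz (fun_upd pp k p) k) (fun_upd pp k p k))"
    unfolding perm_seqs_def using k by (intro sum_PiE_resample[symmetric]) auto
  also have "\<dots> = (\<Sum>pp\<in>?\<Omega>. \<Sum>p\<in>?P. noise (zz pp k) p)" by (simp only: z fun_upd_same)
  also have "\<dots> \<le> (\<Sum>pp\<in>?\<Omega>. real (card ?P) * ?N pp)"
    unfolding gap_def by (intro sum_mono noise_le_average)
  also have "\<dots> = real (card ?P) * (\<Sum>pp\<in>?\<Omega>. ?N pp)" by (simp add: sum_distrib_left)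
  finally have avg: "(\<Sum>pp\<in>?\<Omega>. noise (zz pp k) (pp k)) \<le> (\<Sum>pp\<in>?\<Omega>. ?N pp)"
    using cardP by (rule mult_left_le_imp_le)
  have "(\<Sum>pp\<in>?\<Omega>. lyap pp (Suc k) + tau k / 16 * (norm (gradf (xx pp k)))\<^sup>2)
      \<le> (\<Sum>pp\<in>?\<Omega>. lyap pp k + ?c * (?t * noise (zz pp k) (pp k)))"
    using k perm by (intro sum_mono epoch_step) auto
  also have "\<dots> = (\<Sum>pp\<in>?\<Omega>. lyap pp k) + ?c * (?t * (\<Sum>pp\<in>?\<Omega>. noise (zz pp k) (pp k)))"
    by (simp only: sum.distrib sum_distrib_left)
  also have "\<dots> \<le> (\<Sum>pp\<in>?\<Omega>. lyap pp k) + ?c * (?t * (\<Sum>pp\<in>?\<Omega>. ?N pp))"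
    using tau_pos[OF k(1)] by (intro add_left_mono mult_left_mono avg) auto
  also have "?c * (?t * (\<Sum>pp\<in>?\<Omega>. ?N pp)) = (\<Sum>pp\<in>?\<Omega>. ?c * (?t * ?N pp))"
    by (simp only: sum_distrib_left)
  also have "\<dots> = (\<Sum>pp\<in>?\<Omega>. DD * (real m)\<^sup>2 / real b * alpha k ^ 3 * gap pp k)"
    unfolding noise_coefficient coef ..
  also have "\<dots> \<le> (\<Sum>pp\<in>?\<Omega>. DD * (real m)\<^sup>2 / real b * alpha k ^ 3 * lyap pp k)"
    using DD_pos alpha_pos[OF k(1)] gap_le_lyap[OF k(1)] by (intro sum_mono mult_left_mono) auto
  also have "\<dots> = DD * (real m)\<^sup>2 / real b * alpha k ^ 3 * (\<Sum>pp\<in>?\<Omega>. lyap pp k)"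
    by (simp only: sum_distrib_left)
  finally show ?thesis by (simp add: sum.distrib sum_distrib_left distrib_right)
qed

lemma lyap_start: "lyap pp 1 = favg x1 - fbar"
  by (simp add: lyap_def gap_def zz_def uu_def state_def)

text \<open>Kept abstract in \<open>e\<close> and \<open>h\<close> to cover both the pathwise
  quantities and their expectations. The minimum is compared with a weighted mean whose weights
  \<open>tau k / 16\<close> produce the factor \<open>16 * (1 - bet)\<close>.\<close>

lemma Min_le_of_descent:
  fixes e h :: "nat \<Rightarrow> real"
  assumes T: "T \<ge> 1" and c: "0 \<le> c" "c * (\<Sum>k=1..T. alpha k ^ 3) \<le> 1"
    and h: "\<And>k. 0 \<le> h k" and e: "\<And>k. k \<ge> 1 \<Longrightarrow> 0 \<le> e k"
    and step: "\<And>k. 1 \<le> k \<Longrightarrow> k \<le> T \<Longrightarrow> e (Suc k) + tau k / 16 * h k \<le> (1 + c * alpha k ^ 3) * e k"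
  shows "Min (h ` {1..T}) \<le> (1 + 3 * c * (\<Sum>k=1..T. alpha k ^ 3)) / (real m * (\<Sum>k=1..T. alpha k))
    * 16 * (1 - bet) * e 1"
proof -
  let ?M = "Min (h ` {1..T})" and ?a = "\<Sum>k=1..T. alpha k"
  have a: "0 < ?a" using T alpha_pos by (intro sum_pos) auto
  have cs: "c * (\<Sum>k=1..T. alpha k ^ 3) = (\<Sum>k=1..T. c * alpha k ^ 3)" by (simp add: sum_distrib_left)
  have ck: "0 \<le> c * alpha k ^ 3" if "1 \<le> k" for k using c alpha_pos[OF that] by simp
  have "real m / (16 * (1 - bet)) * ?a * ?M = (\<Sum>k=1..T. tau k / 16 * ?M)"
    by (simp add: tau_def sum_distrib_left sum_distrib_right sum_divide_distrib mult_ac)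
  also have "\<dots> \<le> (\<Sum>k=1..T. tau k / 16 * h k)"
  proof (intro sum_mono mult_left_mono)
    fix k assume "k \<in> {1..T}"
    thus "?M \<le> h k" "0 \<le> tau k / 16" using tau_pos[of k] by auto
  qed
  also have "\<dots> \<le> e (Suc T) + (\<Sum>k=1..T. tau k / 16 * h k)" using e by simp
  also have "\<dots> \<le> (\<Prod>k=1..T. 1 + c * alpha k ^ 3) * e 1"
    using step tau_pos h ck by (intro perturbed_descent_sum_le) (auto simp: less_imp_le)
  also have "\<dots> \<le> (1 + 3 * (\<Sum>k=1..T. c * alpha k ^ 3)) * e 1"
    using ck c(2) e[of 1] unfolding cs by (intro mult_right_mono prod_one_plus_le) auto
  also have "(\<Sum>k=1..T. c * alpha k ^ 3) = c * (\<Sum>k=1..T. alpha k ^ 3)" by (rule cs[symmetric])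
  finally have "real m / (16 * (1 - bet)) * ?a * ?M \<le> (1 + 3 * (c * (\<Sum>k=1..T. alpha k ^ 3))) * e 1" .
  hence "real m * ?a * ?M \<le> (1 + 3 * (c * (\<Sum>k=1..T. alpha k ^ 3))) * e 1 * (16 * (1 - bet))"
    using bet by (simp add: pos_divide_le_eq)
  moreover have "0 < real m * ?a" using a m_pos by simp
  ultimately have "?M \<le> (1 + 3 * (c * (\<Sum>k=1..T. alpha k ^ 3))) * e 1 * (16 * (1 - bet)) / (real m * ?a)"
    by (simp add: pos_le_divide_eq mult.commute)
  thus ?thesis by (simp only: mult_ac times_divide_eq_left times_divide_eq_right)
qed

end

theorem theorem4p1:
  fixes F :: "nat \<Rightarrow> 'a::euclidean_space \<Rightarrow> real"
    and g :: "nat \<Rightarrow> 'a \<Rightarrow> 'a"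
    and n b m T :: nat
    and L fbar bet lam :: real
    and alpha :: "nat \<Rightarrow> real"
    and x1 :: 'a
  defines "gradf \<equiv> (\<lambda>x. (1 / real n) *\<^sub>R (\<Sum>i\<in>{1..n}. g i x))"
    and "D \<equiv> 10 / (1 - bet ^ m)^2 * (L / (1 - bet))^3"
  assumes n_pos: "n \<ge> 1" and b_pos: "b \<ge> 1" and nbm: "n = m * b"
    and grad: "\<And>i x. i \<in> {1..n} \<Longrightarrow> (F i has_derivative (\<lambda>h. g i x \<bullet> h)) (at x)"
    and cont: "\<And>i. i \<in> {1..n} \<Longrightarrow> continuous_on UNIV (g i)"
    and L_pos: "L > 0"
    and lip: "\<And>i x y. i \<in> {1..n} \<Longrightarrow> norm (g i x - g i y) \<le> L * norm (x - y)"
    and lower: "\<And>i x. i \<in> {1..n} \<Longrightarrow> F i x \<ge> fbar"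
    and alpha_mono: "\<And>k. k \<ge> 1 \<Longrightarrow> alpha (Suc k) \<le> alpha k"
    and bet: "0 \<le> bet" "bet < 1"
    and lam: "0 \<le> lam" "lam \<le> bet / (1 - bet)"
    and alpha_pos: "\<And>k. k \<ge> 1 \<Longrightarrow> alpha k > 0"
    and alpha_le: "\<And>k. k \<ge> 1 \<Longrightarrow> alpha k \<le> (1 - bet) * (1 - bet ^ m) / (4 * L * real m)"
    and T_pos: "T \<ge> 1"
  shows
    "((\<Sum>k=1..T. alpha k ^ 3) \<le> 1 / (D * real m ^ 3) \<longrightarrow>
       (\<forall>pp. (\<forall>k\<ge>1. pp k permutes {1..n}) \<longrightarrow>
          Min ((\<lambda>k. (norm (gradf (rrm_x g b m alpha bet lam pp x1 k)))\<^sup>2) ` {1..T})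
          \<le> (1 + 3 * D * real m ^ 3 * (\<Sum>k=1..T. alpha k ^ 3)) / (real m * (\<Sum>k=1..T. alpha k))
             * 16 * (1 - bet) * ((1 / real n) * (\<Sum>i\<in>{1..n}. F i x1) - fbar)))
     \<and>
     ((\<Sum>k=1..T. alpha k ^ 3) \<le> real b / (D * real m ^ 2) \<longrightarrow>
       Min ((\<lambda>k. perm_expect n T (\<lambda>pp. (norm (gradf (rrm_x g b m alpha bet lam pp x1 k)))\<^sup>2)) ` {1..T})
       \<le> (1 + 3 * D * real m ^ 2 / real b * (\<Sum>k=1..T. alpha k ^ 3)) / (real m * (\<Sum>k=1..T. alpha k))
          * 16 * (1 - bet) * ((1 / real n) * (\<Sum>i\<in>{1..n}. F i x1) - fbar))"
proof -
  interpret r: rrm F g n b m L fbar bet lam alpha x1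
    using n_pos b_pos nbm grad L_pos lip lower alpha_mono bet lam alpha_pos alpha_le
    by unfold_locales
  have D: "D = r.DD" and gradf: "gradf = r.gradf"
    by (auto simp: D_def r.DD_def gradf_def r.gradf_def)
  have D0: "0 < D" unfolding D by (rule r.DD_pos)
  have m0: "0 < real m" and b0: "0 < real b" using r.m_pos b_pos by simp_all
  let ?A = "\<Sum>k=1..T. alpha k ^ 3" and ?f = "(1 / real n) * (\<Sum>i\<in>{1..n}. F i x1)"
  have f: "?f = r.favg x1" by (simp add: r.favg_def)
  have arbitrary: "Min ((\<lambda>k. (norm (gradf (rrm_x g b m alpha bet lam pp x1 k)))\<^sup>2) ` {1..T})
      \<le> (1 + 3 * D * real m ^ 3 * ?A) / (real m * (\<Sum>k=1..T. alpha k)) * 16 * (1 - bet) * (?f - fbar)"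
    if A: "?A \<le> 1 / (D * real m ^ 3)" and pp: "\<forall>k\<ge>1. pp k permutes {1..n}" for pp
  proof -
    let ?h = "\<lambda>k. (norm (gradf (rrm_x g b m alpha bet lam pp x1 k)))\<^sup>2"
    have "Min (?h ` {1..T}) \<le> (1 + 3 * (D * real m ^ 3) * ?A) / (real m * (\<Sum>k=1..T. alpha k))
        * 16 * (1 - bet) * r.lyap pp 1"
    proof (rule r.Min_le_of_descent[OF T_pos])
      show "D * real m ^ 3 * ?A \<le> 1" using A D0 m0 by (simp add: field_simps)
      fix k :: nat assume "1 \<le> k"
      thus "r.lyap pp (Suc k) + r.tau k / 16 * ?h k \<le> (1 + D * real m ^ 3 * alpha k ^ 3) * r.lyap pp k"
        using r.lyap_step_arbitrary[of k pp] pp unfolding D gradf r.xx_def by blast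
    qed (use D0 r.lyap_nonneg in auto)
    thus ?thesis unfolding r.lyap_start f by (simp only: mult.assoc)
  qed
  have average: "Min ((\<lambda>k. perm_expect n T (\<lambda>pp. (norm (gradf (rrm_x g b m alpha bet lam pp x1 k)))\<^sup>2)) ` {1..T})
      \<le> (1 + 3 * D * real m ^ 2 / real b * ?A) / (real m * (\<Sum>k=1..T. alpha k)) * 16 * (1 - bet) * (?f - fbar)"
    if A: "?A \<le> real b / (D * real m ^ 2)"
  proof -
    let ?h = "\<lambda>k. perm_expect n T (\<lambda>pp. (norm (gradf (rrm_x g b m alpha bet lam pp x1 k)))\<^sup>2)"
    let ?e = "\<lambda>k. perm_expect n T (\<lambda>pp. r.lyap pp k)"
    let ?N = "real (card (perm_seqs n T))"
    have N: "0 < ?N"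
      by (simp add: perm_seqs_def card_PiE card_permutations[OF refl])
    have "Min (?h ` {1..T}) \<le> (1 + 3 * (D * (real m)\<^sup>2 / real b) * ?A) / (real m * (\<Sum>k=1..T. alpha k))
        * 16 * (1 - bet) * ?e 1"
    proof (rule r.Min_le_of_descent[OF T_pos])
      show "D * (real m)\<^sup>2 / real b * ?A \<le> 1" using A D0 m0 b0 by (simp add: field_simps)
      show "0 \<le> ?h k" for k by (simp add: perm_expect_def sum_nonneg)
      show "0 \<le> ?e k" if "1 \<le> k" for k
        using r.lyap_nonneg[OF that] by (simp add: perm_expect_def sum_nonneg)
      fix k :: nat assume "1 \<le> k" "k \<le> T"
      \<comment> \<open>Dividing the summed recursion by the number of permutation sequences gives
        the recursion for expectations.\<close>
      from divide_right_mono[OF r.lyap_step_average[OF this], of ?N]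
      show "?e (Suc k) + r.tau k / 16 * ?h k \<le> (1 + D * (real m)\<^sup>2 / real b * alpha k ^ 3) * ?e k"
        unfolding perm_expect_def D gradf r.xx_def
        by (simp add: add_divide_distrib)
    qed (use D0 b0 in simp)
    moreover have "?e 1 = ?f - fbar"
      unfolding r.lyap_start f perm_expect_def using N by simp
    ultimately show ?thesis by (simp add: mult.assoc)
  qed
  show ?thesis using arbitrary average by blast
qed

end
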